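(* Let $1<p<\infty$ and let $\Omega\subsetneq\mathbb{R}^n$ be a domain. Suppose $\Omega$ admits the pointwise $p$-Hardy inequality, that is, there exists a constant $C>0$ such that $$|u(x)|\le C\,d(x,\partial\Omega)\bigl(\mathcal{M}_{2d(x,\partial\Omega)}|\nabla u|^p(x)\bigr)^{1/p}$$ for all $u\in C_0^\infty(\Omega)$ and every $x\in\Omega$. Then $\Omega$ admits the integral $p$-Hardy inequality, that is, there exists a constant $C'>0$ such that $$\int_\Omega\frac{|u(x)|^p}{d(x,\partial\Omega)^p}\,dx\le C'\int_\Omega|\nabla u(x)|^p\,dx$$ for all $u\in C_0^\infty(\Omega)$.
   Context: $d$ is the Euclidean distance. For $R>0$ and locally integrable $f$, the restricted Hardy--Littlewood maximal function is $\mathcal{M}_R f(x)=\sup_{0<r\le R}\frac{1}{|B(x,r)|}\int_{B(x,r)}|f|\,dy$, where $B(x,r)$ is the open ball and $|\cdot|$ denotes Lebesgue measure. A domain is a nonempty open connected set. *)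

theory Defs
  imports "HOL-Analysis.Analysis"
begin

definition is_domain :: "'a::euclidean_space set \<Rightarrow> bool" where
  "is_domain \<Omega> \<longleftrightarrow> \<Omega> \<noteq> {} \<and> open \<Omega> \<and> connected \<Omega>"

text \<open>\<open>Ck k f\<close>: all iterated directional derivatives of \<open>f\<close> up to order \<open>k\<close> exist and are
  continuous on the whole space.\<close>

primrec Ck :: "nat \<Rightarrow> ('a::euclidean_space \<Rightarrow> real) \<Rightarrow> bool" where
  "Ck 0 f \<longleftrightarrow> continuous_on UNIV f"
| "Ck (Suc k) f \<longleftrightarrow> (\<forall>x. f differentiable (at x)) \<and>
     (\<forall>v. Ck k (\<lambda>x. frechet_derivative f (at x) v))"

text \<open>An element of \<open>C\<^sub>0\<^sup>\<infinity>(\<Omega>)\<close> is identified with its extension by zero to the whole space,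
  which is again smooth because the support is a compact subset of \<open>\<Omega>\<close>.\<close>

definition Cc_infinity :: "'a::euclidean_space set \<Rightarrow> ('a \<Rightarrow> real) set" where
  "Cc_infinity \<Omega> =
     {u. (\<forall>k. Ck k u) \<and> compact (closure {x. u x \<noteq> 0}) \<and> closure {x. u x \<noteq> 0} \<subseteq> \<Omega>}"

definition grad :: "('a::euclidean_space \<Rightarrow> real) \<Rightarrow> 'a \<Rightarrow> 'a" where
  "grad f x = (THE D. GDERIV f x :> D)"

text \<open>Values in \<open>[0, \<infinity>]\<close>, so that an infinite supremum is not collapsed to a junk real.\<close>

definition restricted_maximal :: "real \<Rightarrow> ('a::euclidean_space \<Rightarrow> real) \<Rightarrow> 'a \<Rightarrow> ennreal" where
  "restricted_maximal R f x =
     (SUP r\<in>{0<..R}. (\<integral>\<^sup>+y\<in>ball x r. ennreal \<bar>f y\<bar> \<partial>lebesgue) / emeasure lebesgue (ball x r))"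

text \<open>Powers of extended nonnegative reals, intended for exponents \<open>s > 0\<close> only.\<close>

definition ennreal_powr :: "ennreal \<Rightarrow> real \<Rightarrow> ennreal" where
  "ennreal_powr a s = (if a = top then top else ennreal (enn2real a powr s))"

definition pointwise_hardy :: "real \<Rightarrow> 'a::euclidean_space set \<Rightarrow> bool" where
  "pointwise_hardy p \<Omega> \<longleftrightarrow>
     (\<exists>C>0. \<forall>u\<in>Cc_infinity \<Omega>. \<forall>x\<in>\<Omega>.
        ennreal \<bar>u x\<bar> \<le> ennreal (C * infdist x (frontier \<Omega>)) *
          ennreal_powr
            (restricted_maximal (2 * infdist x (frontier \<Omega>)) (\<lambda>y. norm (grad u y) powr p) x)
            (1 / p))"

definition integral_hardy :: "real \<Rightarrow> 'a::euclidean_space set \<Rightarrow> bool" where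
  "integral_hardy p \<Omega> \<longleftrightarrow>
     (\<exists>C>0. \<forall>u\<in>Cc_infinity \<Omega>.
        (\<integral>\<^sup>+x\<in>\<Omega>. ennreal (\<bar>u x\<bar> powr p / infdist x (frontier \<Omega>) powr p) \<partial>lebesgue)
          \<le> ennreal C * (\<integral>\<^sup>+x\<in>\<Omega>. ennreal (norm (grad u x) powr p) \<partial>lebesgue))"

end

theory Submission
  imports Defs
begin

text \<open>Write \<open>d\<close> for the distance to the boundary. Since the balls in the maximal function at \<open>x\<close> have
  radius at most \<open>2 d x\<close>, the Vitali covering lemma turns the pointwise inequality into the
  weak-type estimate \<open>|{d \<le> s, |u| > t}| \<lesssim> (s / t)\<^sup>p \<integral>\<^bsub>d \<le> 3 s\<^esub> |\<nabla>u|\<^sup>p\<close>. Truncating \<open>u\<close> at the dyadic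
  levels \<open>l\<close> by the smooth functions \<open>u\<^sup>2 / (u\<^sup>2 + l\<^sup>2)\<close> (Maz'ya) upgrades it to the strong estimate
  \<open>\<integral>\<^bsub>d \<le> s\<^esub> |u|\<^sup>p \<lesssim> s\<^sup>p \<integral>\<^bsub>d \<le> 3 s\<^esub> |\<nabla>u|\<^sup>p\<close>. Summing this over dyadic \<open>s\<close> against \<open>s powr (- p - \<beta>)\<close> gives
  a Hardy inequality with the additional weight \<open>d powr (- \<beta>)\<close> and a constant of order \<open>1 / \<beta>\<close>.
  Applying it to \<open>u\<close> times a smooth version of \<open>d powr (\<beta> / p)\<close> removes the weight at the cost of an
  error term with factor of order \<open>\<beta> powr (p - 1)\<close>, which is absorbed for small \<open>\<beta>\<close> because \<open>p > 1\<close>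
  (Wannebo).\<close>

section \<open>Smoothness on open sets\<close>

text \<open>A local version of \<open>Ck\<close>: the weight constructed later is shown to be smooth
  only on \<open>\<Omega>\<close>. Derivatives are taken \<open>at x\<close>, with full
  neighbourhoods, so the notion is meant for open sets.\<close>

primrec Ck_on :: "nat \<Rightarrow> 'a::euclidean_space set \<Rightarrow> ('a \<Rightarrow> real) \<Rightarrow> bool" where
  "Ck_on 0 S f \<longleftrightarrow> continuous_on S f"
| "Ck_on (Suc k) S f \<longleftrightarrow> (\<forall>x\<in>S. f differentiable (at x)) \<and>
     (\<forall>v. Ck_on k S (\<lambda>x. frechet_derivative f (at x) v))"

lemma Ck_on_UNIV: "Ck_on k UNIV f \<longleftrightarrow> Ck k f"
  by (induction k arbitrary: f) auto

lemma Ck_on_subset: "Ck_on k S f \<Longrightarrow> T \<subseteq> S \<Longrightarrow> Ck_on k T f"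
  by (induction k arbitrary: f) (auto intro: continuous_on_subset)

lemma Ck_on_Un:
  "open S \<Longrightarrow> open T \<Longrightarrow> Ck_on k S f \<Longrightarrow> Ck_on k T f \<Longrightarrow> Ck_on k (S \<union> T) f"
  by (induction k arbitrary: f) (auto intro: continuous_on_open_Un)

text \<open>On an open set, equality at all points is equality near each point, so the Frechet
  derivatives agree there and the induction can pass to them.\<close>

lemma Ck_on_cong:
  assumes "open S" "\<And>x. x \<in> S \<Longrightarrow> f x = g x" "Ck_on k S f"
  shows "Ck_on k S g"
  using assms(2,3)
proof (induction k arbitrary: f g)
  case 0
  then show ?case by (simp add: continuous_on_eq[of S f])
next
  case (Suc k)
  have der: "(g has_derivative frechet_derivative f (at x)) (at x)" if "x \<in> S" for x
  proof (rule has_derivative_transform_within_open[OF _ \<open>open S\<close> that])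
    show "(f has_derivative frechet_derivative f (at x)) (at x)"
      using Suc.prems(2) that by (simp add: frechet_derivative_works[symmetric])
  qed (use Suc.prems(1) in blast)
  have "Ck_on k S (\<lambda>x. frechet_derivative g (at x) v)" for v
    by (rule Suc.IH[of "\<lambda>x. frechet_derivative f (at x) v"])
      (use Suc.prems(2) in \<open>simp_all add: frechet_derivative_at[OF der, symmetric]\<close>)
  moreover have "g differentiable (at x)" if "x \<in> S" for x
    using der[OF that] by (rule differentiableI)
  ultimately show ?case by simp
qed

text \<open>Smoothness can be read off an explicit derivative \<open>D\<close>: by uniqueness it
  equals \<open>frechet_derivative\<close> on \<open>S\<close>, and \<open>Ck_on_cong\<close> does
  the replacement.\<close>

lemma Ck_on_SucI:
  assumes "open S" "\<And>x. x \<in> S \<Longrightarrow> (f has_derivative D x) (at x)"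
    and "\<And>v. Ck_on k S (\<lambda>x. D x v)"
  shows "Ck_on (Suc k) S f"
  unfolding Ck_on.simps
proof (intro conjI ballI allI)
  fix v
  show "Ck_on k S (\<lambda>x. frechet_derivative f (at x) v)"
    by (rule Ck_on_cong[OF assms(1) _ assms(3)[of v]])
      (simp add: frechet_derivative_at[OF assms(2), symmetric])
qed (rule differentiableI[OF assms(2)])

lemma Ck_on_SucD:
  assumes "Ck_on (Suc k) S f" "x \<in> S"
  shows "(f has_derivative frechet_derivative f (at x)) (at x)"
  using assms by (simp add: frechet_derivative_works[symmetric])

lemma Ck_on_continuous: "Ck_on k S f \<Longrightarrow> continuous_on S f"
  by (cases k)
    (simp_all add: continuous_at_imp_continuous_on differentiable_imp_continuous_within)

lemma Ck_on_Suc_imp: "Ck_on (Suc k) S f \<Longrightarrow> Ck_on k S f"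
proof (induction k arbitrary: f)
  case 0
  then have "continuous_on S f" by (rule Ck_on_continuous)
  then show ?case by simp
next
  case (Suc k)
  have "Ck_on (Suc k) S (\<lambda>x. frechet_derivative f (at x) v)" for v
    using Suc.prems by (simp only: Ck_on.simps(2)[of "Suc k"])
  then have "Ck_on k S (\<lambda>x. frechet_derivative f (at x) v)" for v
    by (rule Suc.IH)
  moreover have "\<forall>x\<in>S. f differentiable (at x)"
    using Suc.prems by simp
  ultimately show ?case
    by simp
qed

lemma Ck_on_const: "open S \<Longrightarrow> Ck_on k S (\<lambda>x. c)"
proof (induction k arbitrary: c)
  case (Suc k)
  then show ?case by (intro Ck_on_SucI[where D = "\<lambda>_ _. 0"]) auto
qed simp

lemma Ck_on_inner: "open S \<Longrightarrow> Ck_on k S (\<lambda>x. inner x c)"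
proof (cases k)
  case (Suc k)
  assume "open S"
  then show ?thesis unfolding Suc
    by (intro Ck_on_SucI[where D = "\<lambda>_ v. inner v c"])
      (auto intro!: derivative_eq_intros Ck_on_const)
qed (auto intro!: continuous_intros)

lemma Ck_on_add:
  "open S \<Longrightarrow> Ck_on k S f \<Longrightarrow> Ck_on k S g \<Longrightarrow> Ck_on k S (\<lambda>x. f x + g x)"
proof (induction k arbitrary: f g)
  case (Suc k)
  have "((\<lambda>x. f x + g x) has_derivative
      (\<lambda>v. frechet_derivative f (at x) v + frechet_derivative g (at x) v)) (at x)"
    if "x \<in> S" for x
    by (intro has_derivative_add Ck_on_SucD[OF Suc.prems(2) that] Ck_on_SucD[OF Suc.prems(3) that])
  moreover have "Ck_on k S (\<lambda>x. frechet_derivative f (at x) v + frechet_derivative g (at x) v)" for v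
    using Suc.prems by (intro Suc.IH) auto
  ultimately show ?case
    by (rule Ck_on_SucI[OF Suc.prems(1)])
qed (auto intro: continuous_on_add)

lemma Ck_on_mult:
  "open S \<Longrightarrow> Ck_on k S f \<Longrightarrow> Ck_on k S g \<Longrightarrow> Ck_on k S (\<lambda>x. f x * g x)"
proof (induction k arbitrary: f g)
  case (Suc k)
  have "((\<lambda>x. f x * g x) has_derivative
      (\<lambda>v. f x * frechet_derivative g (at x) v + frechet_derivative f (at x) v * g x)) (at x)"
    if "x \<in> S" for x
    by (intro has_derivative_mult Ck_on_SucD[OF Suc.prems(2) that] Ck_on_SucD[OF Suc.prems(3) that])
  \<comment> \<open>The product rule leaves one factor undifferentiated in each summand, so both
    factors are also used at the lower order \<open>k\<close>.\<close>
  moreover have "Ck_on k S f" "Ck_on k S g"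
    using Suc.prems Ck_on_Suc_imp by blast+
  then have "Ck_on k S (\<lambda>x. f x * frechet_derivative g (at x) v + frechet_derivative f (at x) v * g x)" for v
    using Suc.prems by (intro Ck_on_add Suc.IH) auto
  ultimately show ?case
    by (rule Ck_on_SucI[OF Suc.prems(1)])
qed (auto intro: continuous_on_mult)

lemma Ck_on_sum:
  assumes "open S" "\<And>i. i \<in> I \<Longrightarrow> Ck_on k S (f i)"
  shows "Ck_on k S (\<lambda>x. \<Sum>i\<in>I. f i x)"
  using assms(2) by (induction I rule: infinite_finite_induct)
    (auto intro: Ck_on_const Ck_on_add assms(1))

text \<open>Differentiation turns the exponent \<open>a\<close> into \<open>a - 1\<close>, hence the
  induction treats all exponents at once.\<close>

lemma Ck_on_powr:
  assumes "open S" "Ck_on k S f" "\<And>x. x \<in> S \<Longrightarrow> f x > 0"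
  shows "Ck_on k S (\<lambda>x. f x powr a)"
  using assms(2)
proof (induction k arbitrary: a)
  case 0
  then show ?case using assms(3)
    by (auto intro!: continuous_on_powr continuous_on_const) (metis less_irrefl)
next
  case (Suc k)
  have "((\<lambda>x. f x powr a) has_derivative
      (\<lambda>v. a * f x powr (a - 1) * frechet_derivative f (at x) v)) (at x)" if "x \<in> S" for x
    using assms(3)[OF that] Ck_on_SucD[OF Suc.prems that]
    by (auto intro!: derivative_eq_intros simp: powr_diff field_simps)
  moreover have "Ck_on k S f"
    using Suc.prems by (rule Ck_on_Suc_imp)
  then have "Ck_on k S (\<lambda>x. a * f x powr (a - 1) * frechet_derivative f (at x) v)" for v
    using Suc assms(1) by (intro Ck_on_mult Ck_on_const) auto
  ultimately show ?case
    by (rule Ck_on_SucI[OF assms(1)])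
qed

lemma Ck_on_inner_diff_self:
  fixes y :: "'a::euclidean_space"
  assumes "open S"
  shows "Ck_on k S (\<lambda>x. inner (x - y) (x - y))"
proof -
  have "Ck_on k S (\<lambda>x. \<Sum>b\<in>Basis. (inner x b + (- inner y b)) * (inner x b + (- inner y b)))"
    by (intro Ck_on_sum Ck_on_mult Ck_on_add Ck_on_inner Ck_on_const assms)
  then show ?thesis
    by (subst euclidean_inner) (simp add: inner_diff_left)
qed

section \<open>Gradients and compactly supported smooth functions\<close>

lemma grad_eqI: "GDERIV f x :> D \<Longrightarrow> grad f x = D"
  unfolding grad_def
proof (rule the_equality)
  fix D' assume "GDERIV f x :> D" "GDERIV f x :> D'"
  then have "(\<lambda>h. inner h D) = (\<lambda>h. inner h D')"
    unfolding gderiv_def by (rule has_derivative_unique)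
  then show "D' = D"
    by (metis vector_eq_ldot)
qed

text \<open>The Riesz representation of the derivative in coordinates. The explicit sum also yields
  continuity of \<open>grad\<close> for functions of class C^1.\<close>

lemma GDERIV_frechet_derivative:
  assumes "f differentiable (at x)"
  shows "GDERIV f x :> (\<Sum>b\<in>Basis. frechet_derivative f (at x) b *\<^sub>R b)"
proof -
  interpret linear "frechet_derivative f (at x)"
    using assms by (rule linear_frechet_derivative)
  have *: "frechet_derivative f (at x) h
      = inner h (\<Sum>b\<in>Basis. frechet_derivative f (at x) b *\<^sub>R b)" for h
  proof -
    have "frechet_derivative f (at x) h = frechet_derivative f (at x) (\<Sum>b\<in>Basis. inner h b *\<^sub>R b)"
      by (simp add: euclidean_representation)
    also have "\<dots> = (\<Sum>b\<in>Basis. inner h b * frechet_derivative f (at x) b)"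
      by (simp only: sum scale real_scaleR_def)
    finally show ?thesis
      by (simp only: inner_sum_right inner_scaleR_right mult.commute)
  qed
  show ?thesis
    using assms unfolding gderiv_def frechet_derivative_works *[symmetric] by simp
qed

lemma GDERIV_grad: "f differentiable (at x) \<Longrightarrow> GDERIV f x :> grad f x"
  using GDERIV_frechet_derivative grad_eqI by metis

lemma continuous_on_grad:
  assumes "Ck 1 f"
  shows "continuous_on UNIV (grad f)"
proof -
  have "grad f = (\<lambda>x. \<Sum>b\<in>Basis. frechet_derivative f (at x) b *\<^sub>R b)"
    using assms by (auto intro!: grad_eqI GDERIV_frechet_derivative)
  then show ?thesis
    using assms by (auto intro!: continuous_intros)
qed

lemma Cc_infinity_Ck: "u \<in> Cc_infinity \<Omega> \<Longrightarrow> Ck k u"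
  by (auto simp: Cc_infinity_def)

lemma Cc_infinity_differentiable: "u \<in> Cc_infinity \<Omega> \<Longrightarrow> u differentiable (at x)"
  using Cc_infinity_Ck[of u \<Omega> 1] by auto

lemma Cc_infinity_continuous: "u \<in> Cc_infinity \<Omega> \<Longrightarrow> continuous_on UNIV u"
  using Cc_infinity_Ck[of u \<Omega> 0] by auto

lemma Cc_infinity_continuous_grad: "u \<in> Cc_infinity \<Omega> \<Longrightarrow> continuous_on UNIV (grad u)"
  using Cc_infinity_Ck continuous_on_grad by blast

lemma grad_eq_0:
  assumes "x \<notin> closure {x. u x \<noteq> 0}"
  shows "grad u x = 0"
proof (rule grad_eqI)
  have "((\<lambda>_. 0) has_derivative (\<lambda>h. inner h 0)) (at x)"
    by simp
  then show "GDERIV u x :> 0"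
    unfolding gderiv_def
    by (rule has_derivative_transform_within_open[of _ _ _ UNIV "- closure {x. u x \<noteq> 0}"])
      (use assms closure_subset[of "{x. u x \<noteq> 0}"] in auto)
qed

lemma Cc_infinity_bounded:
  assumes "u \<in> Cc_infinity \<Omega>"
  shows "bounded (range u)"
proof -
  let ?K = "closure {x. u x \<noteq> 0}"
  have "compact (u ` ?K)"
    using assms continuous_on_subset[OF Cc_infinity_continuous[OF assms] subset_UNIV]
    unfolding Cc_infinity_def by (intro compact_continuous_image) auto
  moreover have "range u \<subseteq> insert 0 (u ` ?K)"
    using closure_subset[of "{x. u x \<noteq> 0}"] by auto
  ultimately show ?thesis
    by (metis bounded_insert bounded_subset compact_imp_bounded)
qed

text \<open>The product is smooth on \<open>\<Omega>\<close> and vanishes on the open complement of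
  the support of \<open>u\<close>. These two open sets cover the space, so nothing about
  \<open>w\<close> outside \<open>\<Omega>\<close> matters.\<close>

lemma Cc_infinity_mult:
  assumes u: "u \<in> Cc_infinity \<Omega>" and "open \<Omega>" and w: "\<And>k. Ck_on k \<Omega> w"
  shows "(\<lambda>x. u x * w x) \<in> Cc_infinity \<Omega>"
proof -
  let ?K = "closure {x. u x \<noteq> 0}"
  have sub: "closure {x. u x * w x \<noteq> 0} \<subseteq> ?K"
    by (rule closure_mono) auto
  have K: "compact ?K" "?K \<subseteq> \<Omega>"
    using u by (auto simp: Cc_infinity_def)
  have "Ck_on k (\<Omega> \<union> - ?K) (\<lambda>x. u x * w x)" for k
  proof (rule Ck_on_Un)
    have "Ck_on k \<Omega> u"
      using u by (auto simp: Cc_infinity_def Ck_on_UNIV[symmetric] intro: Ck_on_subset)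
    then show "Ck_on k \<Omega> (\<lambda>x. u x * w x)"
      by (intro Ck_on_mult w assms)
    show "Ck_on k (- ?K) (\<lambda>x. u x * w x)"
      by (rule Ck_on_cong[OF _ _ Ck_on_const[of _ _ 0]])
        (use closure_subset[of "{x. u x \<noteq> 0}"] in auto)
  qed (use \<open>open \<Omega>\<close> in auto)
  moreover have "\<Omega> \<union> - ?K = UNIV"
    using K by auto
  ultimately have "Ck k (\<lambda>x. u x * w x)" for k
    by (simp add: Ck_on_UNIV)
  moreover have "compact (closure {x. u x * w x \<noteq> 0})"
    using compact_Int_closed[OF K(1) closed_closure[of "{x. u x * w x \<noteq> 0}"]] sub
    by (simp add: Int_absorb1)
  ultimately show ?thesis
    using sub K by (auto simp: Cc_infinity_def)
qed

section \<open>The covering argument behind the weak-type estimate\<close>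

text \<open>Vitali gives disjoint balls whose 5-fold enlargements still cover \<open>E\<close>.
  Enlarging costs \<open>5 ^ DIM('a)\<close>, and the integrals over the disjoint balls add up to at
  most the integral over \<open>F\<close>.\<close>

lemma emeasure_le_Vitali:
  fixes g :: "'a::euclidean_space \<Rightarrow> ennreal"
  assumes g: "g \<in> borel_measurable borel" and F: "F \<in> sets borel"
    and cov: "\<And>x. x \<in> E \<Longrightarrow> \<exists>r>0. r \<le> R \<and> ball x r \<subseteq> F \<and>
      emeasure lborel (ball x r) \<le> (\<integral>\<^sup>+y\<in>ball x r. g y \<partial>lborel)"
  shows "emeasure lborel E \<le> 5 ^ DIM('a) * (\<integral>\<^sup>+y\<in>F. g y \<partial>lborel)"
proof -
  obtain r where r: "\<And>x. x \<in> E \<Longrightarrow> 0 < r x \<and> r x \<le> R \<and> ball x (r x) \<subseteq> F \<and>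
      emeasure lborel (ball x (r x)) \<le> (\<integral>\<^sup>+y\<in>ball x (r x). g y \<partial>lborel)"
    using cov by metis
  have sub: "E \<subseteq> (\<Union>i\<in>E. ball i (r i))" and rR: "\<And>i. i \<in> E \<Longrightarrow> 0 < r i \<and> r i \<le> R"
    using r by force+
  obtain I where I: "countable I" "I \<subseteq> E"
      and dj: "pairwise (\<lambda>i j. disjnt (ball i (r i)) (ball j (r j))) I"
      and cover: "E \<subseteq> (\<Union>i\<in>I. ball i (5 * r i))"
    by (rule Vitali_covering_lemma_balls[OF sub rR])
  define N where "N = to_nat_on I ` I"
  define c where "c = from_nat_into I"
  have c: "c n \<in> I" "to_nat_on I (c n) = n" if "n \<in> N" for n
    using that I(1) by (auto simp: N_def c_def)
  define A where "A k n = (if n \<in> N then ball (c n) (k * r (c n)) else {})" for k n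
  \<comment> \<open>With the integral viewed as a measure, summing over disjoint balls is countable
    additivity.\<close>
  define \<mu> where "\<mu> = density lborel g"
  have [measurable]: "A k n \<in> sets borel" for k n
    by (simp add: A_def)
  have \<mu>: "emeasure \<mu> X = (\<integral>\<^sup>+y\<in>X. g y \<partial>lborel)" if "X \<in> sets borel" for X
    unfolding \<mu>_def using g that by (intro emeasure_density) auto
  have le: "emeasure lborel (A 5 n) \<le> 5 ^ DIM('a) * emeasure \<mu> (A 1 n)" for n
  proof (cases "n \<in> N")
    case True
    let ?r = "r (c n)"
    have rn: "0 < ?r" "emeasure lborel (ball (c n) ?r) \<le> (\<integral>\<^sup>+y\<in>ball (c n) ?r. g y \<partial>lborel)"
      using r c(1)[OF True] I(2) by auto
    have "emeasure lborel (ball (c n) (5 * ?r)) = 5 ^ DIM('a) * emeasure lborel (ball (c n) ?r)"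
      using rn(1) unit_ball_vol_nonneg[of "real DIM('a)"]
      by (simp add: emeasure_ball power_mult_distrib ennreal_mult'' ennreal_power[symmetric] mult_ac
          flip: ennreal_numeral)
    also have "\<dots> \<le> 5 ^ DIM('a) * (\<integral>\<^sup>+y\<in>ball (c n) ?r. g y \<partial>lborel)"
      by (intro mult_left_mono rn) auto
    finally show ?thesis
      using True by (simp add: A_def \<mu>)
  qed (simp add: A_def)
  have disj: "disjoint_family (A 1)"
    unfolding disjoint_family_on_def
  proof (intro ballI impI)
    fix m n :: nat assume "m \<noteq> n"
    show "A 1 m \<inter> A 1 n = {}"
    proof (cases "m \<in> N \<and> n \<in> N")
      case True
      then have "c m \<noteq> c n"
        using c(2) \<open>m \<noteq> n\<close> by metis
      then have "disjnt (ball (c m) (r (c m))) (ball (c n) (r (c n)))"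
        using dj c(1) True by (auto simp: pairwise_def)
      then show ?thesis
        using True by (simp add: A_def disjnt_def)
    qed (auto simp: A_def)
  qed
  have "E \<subseteq> (\<Union>n. A 5 n)"
  proof
    fix x assume "x \<in> E"
    then obtain i where "i \<in> I" "x \<in> ball i (5 * r i)"
      using cover by blast
    then have "x \<in> A 5 (to_nat_on I i)"
      using I(1) by (simp add: A_def N_def c_def)
    then show "x \<in> (\<Union>n. A 5 n)"
      by blast
  qed
  then have "emeasure lborel E \<le> emeasure lborel (\<Union>n. A 5 n)"
    by (intro emeasure_mono) auto
  also have "\<dots> \<le> (\<Sum>n. emeasure lborel (A 5 n))"
    by (intro emeasure_subadditive_countably) auto
  also have "\<dots> \<le> (\<Sum>n. 5 ^ DIM('a) * emeasure \<mu> (A 1 n))"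
    by (intro suminf_le le) auto
  also have "\<dots> = 5 ^ DIM('a) * (\<Sum>n. emeasure \<mu> (A 1 n))"
    by simp
  also have "(\<Sum>n. emeasure \<mu> (A 1 n)) = emeasure \<mu> (\<Union>n. A 1 n)"
    using disj by (intro suminf_emeasure) (auto simp: \<mu>_def)
  also have "\<dots> \<le> emeasure \<mu> F"
  proof (rule emeasure_mono)
    show "(\<Union>n. A 1 n) \<subseteq> F"
      using r c(1) I(2) by (fastforce simp: A_def split: if_splits)
  qed (use F in \<open>simp add: \<mu>_def\<close>)
  also have "emeasure \<mu> F = (\<integral>\<^sup>+y\<in>F. g y \<partial>lborel)"
    using F by (rule \<mu>)
  finally show ?thesis
    by (simp add: mult_left_mono)
qed

section \<open>Elementary inequalities for dyadic sums, powers and truncations\<close>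

text \<open>Take the least \<open>j\<close> with \<open>M / 2 ^ Suc j < a\<close>. This serves both
  for the levels of \<open>u\<close> and for the distances to the boundary.\<close>

lemma ex_dyadic:
  fixes a M :: real
  assumes "0 < a" "a \<le> M"
  shows "\<exists>j. M / 2 ^ Suc j < a \<and> a \<le> M / 2 ^ j"
proof -
  have "M > 0" using assms by simp
  define P where "P = (\<lambda>j. M / 2 ^ Suc j < a)"
  obtain n where "(1/2) ^ n < a / M"
    using real_arch_pow_inv[of "a / M" "1/2"] assms by auto
  then have n: "M / 2 ^ n < a"
    using \<open>M > 0\<close> by (simp add: field_simps power_one_over)
  then have "M / 2 ^ Suc n < a"
    using \<open>M > 0\<close> by (rule_tac le_less_trans[OF _ n]) (simp add: field_simps)
  then have "\<exists>n. P n" by (auto simp: P_def)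
  then have L: "P (LEAST n. P n)" by (rule LeastI_ex)
  have "a \<le> M / 2 ^ (LEAST n. P n)"
  proof (cases "LEAST n. P n")
    case 0
    then show ?thesis using assms by (metis div_by_1 power_0)
  next
    case (Suc m)
    then have "\<not> P m" using not_less_Least[of m P] by simp
    then show ?thesis unfolding Suc by (simp add: P_def)
  qed
  then show ?thesis using L P_def by blast
qed

lemma sum_truncated_geometric_le:
  fixes q b c :: real
  assumes "1 \<le> q" "0 \<le> b" "0 \<le> c"
  shows "(\<Sum>i<n. if c * q ^ i \<le> b then c * q ^ i else 0) * (q - 1) \<le> q * b"
proof -
  \<comment> \<open>The invariant for the induction: as long as the terms count, the geometric sum
    telescopes below \<open>c * q ^ n\<close>; once they exceed \<open>b\<close> they are zero and
    the bound \<open>q * b\<close> persists.\<close>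
  have "(\<Sum>i<n. if c * q ^ i \<le> b then c * q ^ i else 0) * (q - 1) \<le> min (c * q ^ n) (q * b)"
  proof (induction n)
    case 0
    then show ?case using assms by simp
  next
    case (Suc n)
    let ?S = "(\<Sum>i<n. if c * q ^ i \<le> b then c * q ^ i else 0)"
    show ?case
    proof (cases "c * q ^ n \<le> b")
      case True
      have "(?S + c * q ^ n) * (q - 1) \<le> c * q ^ n + c * q ^ n * (q - 1)"
        using Suc by (simp add: distrib_right)
      also have "\<dots> = q * (c * q ^ n)"
        by (simp add: algebra_simps)
      finally have "(?S + c * q ^ n) * (q - 1) \<le> q * (c * q ^ n)" .
      moreover have "q * (c * q ^ n) \<le> q * b"
        using True assms by (intro mult_left_mono) auto
      ultimately show ?thesis using True by (simp add: mult_ac)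
    next
      case False
      have "c * q ^ n \<le> c * q ^ Suc n"
        using assms by (intro mult_left_mono power_increasing) auto
      then show ?thesis using False Suc by auto
    qed
  qed
  then show ?thesis by simp
qed

text \<open>The summands are the gradient factors of the smooth truncations at dyadic levels. Their
  uniformly bounded sum replaces the disjoint gradient supports of sharp truncations. As the factors
  lie in [0, 1], the power \<open>p\<close> may be dropped.\<close>

lemma sum_truncation_weight_le:
  fixes \<tau> p :: real
  assumes "0 \<le> \<tau>" "1 \<le> p"
  shows "(\<Sum>j<n. (2 * (\<tau> * 2 ^ j) / (1 + (\<tau> * 2 ^ j)\<^sup>2)\<^sup>2) powr p) \<le> 12"
proof -
  \<comment> \<open>The summands are dominated by the increments of \<open>F\<close> along the dyadic scale.\<close>
  define F where "F t = t / (1 + t)" for t :: real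
  have step: "(2 * t / (1 + t\<^sup>2)\<^sup>2) powr p \<le> 12 * (F (2 * t) - F t)" if t: "0 \<le> t" for t
  proof -
    let ?h = "2 * t / (1 + t\<^sup>2)\<^sup>2"
    have sq: "0 \<le> (t - 1)\<^sup>2" by simp
    have 1: "2 * t \<le> 1 + t\<^sup>2"
      using sq by (simp add: power2_eq_square algebra_simps)
    have "1 + t\<^sup>2 \<le> (1 + t\<^sup>2)\<^sup>2"
      by (rule self_le_power) auto
    with 1 have h: "0 \<le> ?h" "?h \<le> 1"
      using t by (auto simp: divide_le_eq)
    have "?h powr p \<le> ?h"
    proof (cases "?h = 0")
      case False
      then have "?h powr p \<le> ?h powr 1"
        using h assms(2) by (intro powr_mono') auto
      then show ?thesis using h by simp
    next
      case True
      then show ?thesis unfolding True using assms by simp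
    qed
    also have "?h \<le> 12 * (t / ((1 + t) * (1 + 2 * t)))"
    proof -
      have "(1 + t) * (1 + 2 * t) \<le> 6 * (1 + t\<^sup>2)"
      proof -
        have "6 * (1 + t\<^sup>2) - (1 + t) * (1 + 2 * t) = 4 * (t - 1)\<^sup>2 + 5 * t + 1"
          by (simp add: power2_eq_square algebra_simps)
        then show ?thesis using sq t by linarith
      qed
      also have "\<dots> \<le> 6 * (1 + t\<^sup>2)\<^sup>2"
        using \<open>1 + t\<^sup>2 \<le> (1 + t\<^sup>2)\<^sup>2\<close> by simp
      finally have *: "(1 + t) * (1 + 2 * t) \<le> 6 * (1 + t\<^sup>2)\<^sup>2" .
      have "12 * (t / ((1 + t) * (1 + 2 * t))) \<ge> 12 * (t / (6 * (1 + t\<^sup>2)\<^sup>2))"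
        using t * by (intro mult_left_mono divide_left_mono)
          (auto intro!: mult_pos_pos add_pos_nonneg zero_less_power)
      then show ?thesis by simp
    qed
    also have "t / ((1 + t) * (1 + 2 * t)) = F (2 * t) - F t"
      using t by (simp add: F_def divide_simps) (simp add: algebra_simps)
    finally show ?thesis .
  qed
  have "(\<Sum>j<n. (2 * (\<tau> * 2 ^ j) / (1 + (\<tau> * 2 ^ j)\<^sup>2)\<^sup>2) powr p)
      \<le> (\<Sum>j<n. 12 * (F (\<tau> * 2 ^ Suc j) - F (\<tau> * 2 ^ j)))"
  proof (intro sum_mono)
    fix j
    show "(2 * (\<tau> * 2 ^ j) / (1 + (\<tau> * 2 ^ j)\<^sup>2)\<^sup>2) powr p
        \<le> 12 * (F (\<tau> * 2 ^ Suc j) - F (\<tau> * 2 ^ j))"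
      using step[of "\<tau> * 2 ^ j"] assms(1) by (simp add: mult_ac)
  qed
  also have "\<dots> = 12 * (F (\<tau> * 2 ^ n) - F \<tau>)"
    using sum_lessThan_telescope[of "\<lambda>j. F (\<tau> * 2 ^ j)" n]
    unfolding sum_distrib_left[symmetric] by simp
  also have "\<dots> \<le> 12 * (1 - 0)"
    using assms(1) by (intro mult_left_mono diff_mono) (auto simp: F_def divide_le_eq add_pos_nonneg)
  finally show ?thesis by simp
qed

lemma powr_add_le:
  fixes a b p :: real
  assumes "0 \<le> a" "0 \<le> b" "0 \<le> p"
  shows "(a + b) powr p \<le> 2 powr p * (a powr p + b powr p)"
proof -
  have "(a + b) powr p \<le> (2 * max a b) powr p"
    using assms by (intro powr_mono2) auto
  also have "\<dots> = 2 powr p * max a b powr p"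
    using assms by (simp add: powr_mult)
  also have "\<dots> \<le> 2 powr p * (a powr p + b powr p)"
    by (intro mult_left_mono) (auto simp: max_def)
  finally show ?thesis .
qed

text \<open>Young's inequality gives \<open>(1/2) powr \<beta> \<le> 1 - \<beta> / 2\<close>;
  multiply by \<open>2 powr \<beta>\<close>. This makes a geometric series of ratio
  \<open>2 powr \<beta>\<close> cost only a factor of order \<open>1 / \<beta>\<close>.\<close>

lemma half_powr_le:
  fixes \<beta> :: real
  assumes "0 < \<beta>" "\<beta> \<le> 1"
  shows "\<beta> * 2 powr \<beta> \<le> 2 * (2 powr \<beta> - 1)"
proof -
  have "(1/2) powr \<beta> * 1 powr (1 - \<beta>) \<le> \<beta> * (1/2) + (1 - \<beta>) * 1"
    using assms by (intro Youngs_inequality_0) auto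
  then show ?thesis
    by (simp add: powr_divide field_simps)
qed

text \<open>The function is u^2 / (u^2 + l^2), written as \<open>u\<close> times a factor built with
  \<open>powr\<close> so that \<open>Cc_infinity_mult\<close> and \<open>Ck_on_powr\<close> apply to
  it.\<close>

lemma GDERIV_truncation:
  assumes "GDERIV u x :> D" "0 < l"
  shows "GDERIV (\<lambda>x. u x * (u x * (u x * u x + l\<^sup>2) powr (-1))) x :>
    (2 * u x * l\<^sup>2 / ((u x)\<^sup>2 + l\<^sup>2)\<^sup>2) *\<^sub>R D"
proof -
  have pos: "0 < t * t + l\<^sup>2" for t :: real
    using assms(2) by (intro add_nonneg_pos) auto
  have "((\<lambda>t. t * (t * (t * t + l\<^sup>2) powr (-1))) has_real_derivative
      2 * t * l\<^sup>2 / (t\<^sup>2 + l\<^sup>2)\<^sup>2) (at t)" for t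
  proof -
    have "((\<lambda>t. t * (t / (t * t + l\<^sup>2))) has_real_derivative
      2 * t * l\<^sup>2 / (t\<^sup>2 + l\<^sup>2)\<^sup>2) (at t)"
      using pos[of t]
      by (auto intro!: derivative_eq_intros simp: power2_eq_square field_simps)
    moreover have "t * (t * (t * t + l\<^sup>2) powr (-1)) = t * (t / (t * t + l\<^sup>2))" for t
      using pos[of t] by (simp add: powr_minus divide_inverse)
    ultimately show ?thesis by presburger
  qed
  then show ?thesis
    by (rule GDERIV_DERIV_compose[OF assms(1)])
qed

text \<open>Scale-invariant form: apart from the final \<open>1 / l\<close>, only the ratio
  \<open>\<bar>t\<bar> / l\<close> enters, as in \<open>sum_truncation_weight_le\<close>.\<close>

lemma abs_truncation_deriv:
  fixes t l :: real
  assumes "0 < l"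
  shows "\<bar>2 * t * l\<^sup>2 / (t\<^sup>2 + l\<^sup>2)\<^sup>2\<bar> = 2 * (\<bar>t\<bar> / l) / (1 + (\<bar>t\<bar> / l)\<^sup>2)\<^sup>2 / l"
proof -
  have "1 + (\<bar>t\<bar> / l)\<^sup>2 = (t\<^sup>2 + l\<^sup>2) / l\<^sup>2"
    using assms by (simp add: power_divide field_simps)
  moreover have "2 * (a / l) / (b / l\<^sup>2)\<^sup>2 / l = 2 * a * l\<^sup>2 / b\<^sup>2" for a b :: real
    using assms by (cases "b = 0") (simp_all add: power2_eq_square field_simps)
  ultimately show ?thesis
    by (simp only: abs_mult abs_divide) simp
qed

section \<open>The setting: a fixed constant in the pointwise inequality, and boundary
  layers\<close>

text \<open>A nonempty frontier matters because \<open>infdist\<close> to the empty set is 0 by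
  convention; together with openness it makes the distance positive on
  \<open>\<Omega>\<close>.\<close>

locale pointwise_hardy_domain =
  fixes p C :: real and \<Omega> :: "'a::euclidean_space set"
  assumes p: "1 < p" and C: "0 < C"
    and open_\<Omega>: "open \<Omega>" and frontier_nonempty: "frontier \<Omega> \<noteq> {}"
    and hardy: "\<And>u x. u \<in> Cc_infinity \<Omega> \<Longrightarrow> x \<in> \<Omega> \<Longrightarrow>
        ennreal \<bar>u x\<bar> \<le> ennreal (C * infdist x (frontier \<Omega>)) *
          ennreal_powr
            (restricted_maximal (2 * infdist x (frontier \<Omega>)) (\<lambda>y. norm (grad u y) powr p) x)
            (1 / p)"
begin

abbreviation d :: "'a \<Rightarrow> real" where
  "d x \<equiv> infdist x (frontier \<Omega>)"

definition layer :: "real \<Rightarrow> 'a set" where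
  "layer s = {x \<in> \<Omega>. d x \<le> s}"

lemma d_pos: "x \<in> \<Omega> \<Longrightarrow> 0 < d x"
  using open_\<Omega> frontier_nonempty
  by (intro infdist_pos_not_in_closed) (auto simp: frontier_def interior_open)

lemma borel_measurable_d [measurable]: "d \<in> borel_measurable borel"
  by (intro borel_measurable_continuous_onI continuous_intros)

lemma sets_\<Omega> [measurable]: "\<Omega> \<in> sets borel"
  using open_\<Omega> by simp

lemma sets_layer [measurable]: "layer s \<in> sets borel"
  unfolding layer_def by measurable

lemma Cc_infinity_borel_measurable: "u \<in> Cc_infinity \<Omega> \<Longrightarrow> u \<in> borel_measurable borel"
  by (intro borel_measurable_continuous_onI Cc_infinity_continuous)

lemma Cc_infinity_borel_measurable_grad: "u \<in> Cc_infinity \<Omega> \<Longrightarrow> grad u \<in> borel_measurable borel"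
  by (intro borel_measurable_continuous_onI Cc_infinity_continuous_grad)

lemma Cc_infinity_grad_eq_0: "u \<in> Cc_infinity \<Omega> \<Longrightarrow> x \<notin> \<Omega> \<Longrightarrow> grad u x = 0"
  by (intro grad_eq_0) (auto simp: Cc_infinity_def)

section \<open>The weak-type estimate in a boundary layer\<close>

text \<open>If every admissible ball failed, all averages of the gradient power would be at most
  \<open>1 / k\<close>, hence so would the maximal function, and the pointwise inequality would
  force \<open>\<bar>u x\<bar> \<le> t\<close>.\<close>

lemma ex_ball_emeasure_le:
  assumes u: "u \<in> Cc_infinity \<Omega>" and x: "x \<in> layer s" and t: "0 < t" "t < \<bar>u x\<bar>"
  shows "\<exists>r>0. r \<le> 2 * d x \<and> emeasure lborel (ball x r) \<le>
    (\<integral>\<^sup>+y\<in>ball x r. ennreal ((C * s / t) powr p * norm (grad u y) powr p) \<partial>lborel)"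
proof (rule ccontr)
  assume contra: "\<not> ?thesis"
  note [measurable] = Cc_infinity_borel_measurable_grad[OF u]
  have d: "0 < d x" "d x \<le> s" and "x \<in> \<Omega>"
    using x d_pos by (auto simp: layer_def)
  define G where "G y = norm (grad u y) powr p" for y
  \<comment> \<open>Chosen so that the p-th root of \<open>1 / k\<close> is
    \<open>t / (C * s)\<close>, which cancels the factor \<open>C * d x\<close> down to at most
    \<open>t\<close>.\<close>
  define k where "k = (C * s / t) powr p"
  have k: "k > 0"
    using C d t by (auto simp: k_def)
  have [measurable]: "G \<in> borel_measurable borel" "\<And>r. ball x r \<in> sets borel"
    unfolding G_def by measurable
  have avg: "(\<integral>\<^sup>+y\<in>ball x r. ennreal \<bar>G y\<bar> \<partial>lebesgue) / emeasure lebesgue (ball x r)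
      \<le> ennreal (1 / k)" if r: "r \<in> {0<..2 * d x}" for r
  proof (rule divide_le_posI_ennreal)
    have "emeasure lborel (ball x r) > 0"
      using r unit_ball_vol_pos[of "real DIM('a)"] by (simp add: emeasure_ball)
    then show "0 < emeasure lebesgue (ball x r)"
      by simp
    have kI: "ennreal k * (\<integral>\<^sup>+y\<in>ball x r. ennreal \<bar>G y\<bar> \<partial>lborel) \<le> emeasure lborel (ball x r)"
    proof -
      have "ennreal k * (\<integral>\<^sup>+y\<in>ball x r. ennreal \<bar>G y\<bar> \<partial>lborel)
          = (\<integral>\<^sup>+y. ennreal k * (ennreal \<bar>G y\<bar> * indicator (ball x r) y) \<partial>lborel)"
        by (rule nn_integral_cmult[symmetric]) measurable
      also have "\<dots> = (\<integral>\<^sup>+y\<in>ball x r. ennreal (k * norm (grad u y) powr p) \<partial>lborel)"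
        using k by (simp add: G_def ennreal_mult mult_ac)
      finally show ?thesis
        using contra r by (force simp: k_def)
    qed
    have "(\<integral>\<^sup>+y\<in>ball x r. ennreal \<bar>G y\<bar> \<partial>lborel)
        = ennreal (1 / k) * (ennreal k * (\<integral>\<^sup>+y\<in>ball x r. ennreal \<bar>G y\<bar> \<partial>lborel))"
      using k by (simp add: mult.assoc[symmetric] ennreal_mult[symmetric])
    also have "\<dots> \<le> ennreal (1 / k) * emeasure lborel (ball x r)"
      by (intro mult_left_mono kI) auto
    finally show "(\<integral>\<^sup>+y\<in>ball x r. ennreal \<bar>G y\<bar> \<partial>lebesgue)
        \<le> emeasure lebesgue (ball x r) * ennreal (1 / k)"
      by (simp add: nn_integral_completion mult.commute)
  qed
  let ?M = "restricted_maximal (2 * d x) G x"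
  have M: "?M \<le> ennreal (1 / k)"
    unfolding restricted_maximal_def by (rule SUP_least) (rule avg)
  have kp: "(1 / k) powr (1 / p) = t / (C * s)"
    using p C d t by (simp add: k_def powr_powr powr_divide[symmetric] flip: powr_minus_divide)
  have "ennreal_powr ?M (1 / p) \<le> ennreal (t / (C * s))"
  proof -
    have "enn2real ?M \<le> 1 / k"
      using M k by (simp add: enn2real_leI)
    then have "enn2real ?M powr (1 / p) \<le> (1 / k) powr (1 / p)"
      using p by (intro powr_mono2) auto
    \<comment> \<open>\<open>ennreal_powr\<close> treats \<open>top\<close> separately, so
      finiteness has to be checked before computing with reals.\<close>
    moreover have "?M \<noteq> top"
      using M by (auto simp: top_unique)
    ultimately show ?thesis
      unfolding ennreal_powr_def kp by (simp add: ennreal_leI)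
  qed
  then have "ennreal \<bar>u x\<bar> \<le> ennreal (C * d x) * ennreal (t / (C * s))"
    using hardy[OF u \<open>x \<in> \<Omega>\<close>] by (fold G_def) (meson mult_left_mono order_trans zero_le)
  also have "\<dots> = ennreal (C * d x * (t / (C * s)))"
    using C d t by (intro ennreal_mult[symmetric]) auto
  also have "C * d x * (t / (C * s)) \<le> t"
    using C d t by (simp add: divide_simps)
  then have "ennreal (C * d x * (t / (C * s))) \<le> ennreal t"
    by (rule ennreal_leI)
  finally show False
    using t by simp
qed

text \<open>A ball of radius at most \<open>2 * d x\<close> around a point of \<open>layer s\<close>
  stays where the distance is at most \<open>3 * s\<close>, so the covering lemma applies with that
  set as \<open>F\<close>.\<close>

lemma weak_layer:
  assumes u: "u \<in> Cc_infinity \<Omega>" and s: "0 < s" and t: "0 < t"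
  shows "emeasure lborel {x \<in> layer s. t < \<bar>u x\<bar>} \<le>
    ennreal (5 ^ DIM('a) * (C * s / t) powr p) *
      (\<integral>\<^sup>+y\<in>layer (3 * s). ennreal (norm (grad u y) powr p) \<partial>lborel)"
proof -
  note [measurable] = Cc_infinity_borel_measurable_grad[OF u]
  define k where "k = (C * s / t) powr p"
  have k: "0 \<le> k"
    by (simp add: k_def)
  have "emeasure lborel {x \<in> layer s. t < \<bar>u x\<bar>} \<le> 5 ^ DIM('a) *
      (\<integral>\<^sup>+y\<in>{y. d y \<le> 3 * s}. ennreal (k * norm (grad u y) powr p) \<partial>lborel)"
  proof (rule emeasure_le_Vitali)
    fix x assume x: "x \<in> {x \<in> layer s. t < \<bar>u x\<bar>}"
    then obtain r where r: "r > 0" "r \<le> 2 * d x" and le: "emeasure lborel (ball x r) \<le>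
        (\<integral>\<^sup>+y\<in>ball x r. ennreal (k * norm (grad u y) powr p) \<partial>lborel)"
      using ex_ball_emeasure_le[OF u _ t] by (auto simp: k_def)
    have dx: "d x \<le> s"
      using x by (simp add: layer_def)
    have "d y \<le> 3 * s" if "y \<in> ball x r" for y
      using infdist_triangle[of y "frontier \<Omega>" x] that r dx by (simp add: dist_commute)
    then show "\<exists>r>0. r \<le> 2 * s \<and> ball x r \<subseteq> {y. d y \<le> 3 * s} \<and> emeasure lborel (ball x r) \<le>
        (\<integral>\<^sup>+y\<in>ball x r. ennreal (k * norm (grad u y) powr p) \<partial>lborel)"
      using r le dx by (intro exI[of _ r]) auto
  qed measurable
  \<comment> \<open>The balls may leave \<open>\<Omega>\<close>, but the gradient vanishes outside
    it, so only the part in the layer contributes.\<close>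
  also have "(\<integral>\<^sup>+y\<in>{y. d y \<le> 3 * s}. ennreal (k * norm (grad u y) powr p) \<partial>lborel)
      = (\<integral>\<^sup>+y. ennreal k *
          (ennreal (norm (grad u y) powr p) * indicator (layer (3 * s)) y) \<partial>lborel)"
    using k Cc_infinity_grad_eq_0[OF u]
    by (intro nn_integral_cong) (auto simp: layer_def ennreal_mult split: split_indicator)
  also have "\<dots> = ennreal k *
      (\<integral>\<^sup>+y\<in>layer (3 * s). ennreal (norm (grad u y) powr p) \<partial>lborel)"
    by (rule nn_integral_cmult) measurable
  finally show ?thesis
    using k by (simp add: k_def ennreal_mult mult.assoc ennreal_power[symmetric])
qed

section \<open>From the weak to the strong estimate by smooth truncation\<close>

lemma truncation_in_Cc_infinity:
  assumes u: "u \<in> Cc_infinity \<Omega>" and l: "0 < l"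
  shows "(\<lambda>x. u x * (u x * (u x * u x + l\<^sup>2) powr (-1))) \<in> Cc_infinity \<Omega>"
proof (rule Cc_infinity_mult[OF u open_\<Omega>])
  fix k
  have "Ck_on k \<Omega> u"
    using Cc_infinity_Ck[OF u] Ck_on_UNIV Ck_on_subset by blast
  then show "Ck_on k \<Omega> (\<lambda>x. u x * (u x * u x + l\<^sup>2) powr (-1))"
    by (intro Ck_on_mult Ck_on_powr Ck_on_add Ck_on_const open_\<Omega>)
      (use l in \<open>auto intro: add_nonneg_pos\<close>)
qed

text \<open>The factor 12 comes from \<open>sum_truncation_weight_le\<close>, the power of 5 from
  the covering lemma, and \<open>5 * C\<close> from the threshold \<open>1 / 5\<close> for
  truncations.\<close>

definition layer_const :: real where
  "layer_const = 12 * 5 ^ DIM('a) * (5 * C) powr p"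

lemma layer_const_pos: "0 < layer_const"
  using C by (simp add: layer_const_def)

text \<open>The weak estimate is applied to the truncation of \<open>u\<close> at each dyadic level,
  at a fixed threshold. Summed over the levels, the left sides dominate the integral of the p-th
  power of \<open>u\<close>, while the gradient factors on the right sum to at most 12.\<close>

lemma strong_layer:
  assumes u: "u \<in> Cc_infinity \<Omega>" and s: "0 < s"
  shows "(\<integral>\<^sup>+x\<in>layer s. ennreal (\<bar>u x\<bar> powr p) \<partial>lborel) \<le>
    ennreal (layer_const * s powr p) *
      (\<integral>\<^sup>+x\<in>layer (3 * s). ennreal (norm (grad u x) powr p) \<partial>lborel)"
proof -
  note [measurable] = Cc_infinity_borel_measurable[OF u] Cc_infinity_borel_measurable_grad[OF u]
  obtain M where M: "0 < M" "\<And>x. \<bar>u x\<bar> \<le> M"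
    using Cc_infinity_bounded[OF u] by (auto simp: bounded_pos)
  define l where "l j = M / 2 ^ j" for j :: nat
  have l: "0 < l j" for j
    using M by (simp add: l_def)
  define h where "h \<tau> = 2 * \<tau> / (1 + \<tau>\<^sup>2)\<^sup>2" for \<tau> :: real
  have h: "0 \<le> h \<tau>" if "0 \<le> \<tau>" for \<tau>
    using that by (simp add: h_def)
  \<comment> \<open>The truncation u^2 / (u^2 + l^2) equals \<open>1 / 5\<close> exactly when the
    modulus of \<open>u\<close> is \<open>l / 2\<close>.\<close>
  define k where "k = 5 ^ DIM('a) * (C * s / (1 / 5)) powr p"
  have k: "0 \<le> k"
    by (simp add: k_def)
  define E where "E j = {x \<in> layer s. l j / 2 < \<bar>u x\<bar>}" for j
  have [measurable]: "E j \<in> sets borel" for j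
    unfolding E_def by measurable
  let ?g = "\<lambda>x. ennreal (norm (grad u x) powr p)"
  let ?t = "\<lambda>j x. ennreal (h (\<bar>u x\<bar> / l j) powr p)"
  \<comment> \<open>The gradient of the truncation carries a factor \<open>1 / l j\<close>, whose
    p-th power is compensated by \<open>l j powr p\<close>; the constant does not depend on the
    level.\<close>
  have level: "ennreal (l j powr p) * emeasure lborel (E j) \<le>
      ennreal k * (\<integral>\<^sup>+x. ?t j x * (?g x * indicator (layer (3 * s)) x) \<partial>lborel)" for j
  proof -
    define v where "v x = u x * (u x * (u x * u x + (l j)\<^sup>2) powr (-1))" for x
    have v: "v \<in> Cc_infinity \<Omega>"
      unfolding v_def by (rule truncation_in_Cc_infinity[OF u l])
    have "norm (grad v x) = h (\<bar>u x\<bar> / l j) / l j * norm (grad u x)" for x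
    proof -
      have "GDERIV u x :> grad u x"
        by (rule GDERIV_grad[OF Cc_infinity_differentiable[OF u]])
      from grad_eqI[OF GDERIV_truncation[OF this l[of j]]] show ?thesis
        by (simp only: v_def[abs_def] h_def norm_scaleR abs_truncation_deriv[OF l[of j]])
    qed
    then have gv: "ennreal (norm (grad v x) powr p) =
        ennreal (l j powr (-p)) * (?t j x * ?g x)" for x
      using l[of j] h[of "\<bar>u x\<bar> / l j"]
      by (simp add: powr_mult powr_divide powr_minus_divide ennreal_mult[symmetric])
    have "E j \<subseteq> {x \<in> layer s. 1 / 5 < \<bar>v x\<bar>}"
    proof
      fix x assume x: "x \<in> E j"
      then have lt: "l j < 2 * \<bar>u x\<bar>"
        by (simp add: E_def)
      have "(l j)\<^sup>2 < (2 * \<bar>u x\<bar>)\<^sup>2"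
        using lt l[of j] by (intro power_strict_mono) auto
      then have "(l j)\<^sup>2 < 4 * (u x * u x)"
        by (simp add: power2_eq_square)
      moreover have "0 < u x * u x + (l j)\<^sup>2"
        using l[of j] by (intro add_nonneg_pos) auto
      ultimately have "1 / 5 < (u x * u x) / (u x * u x + (l j)\<^sup>2)"
        by (simp add: less_divide_eq)
      also have "\<dots> = v x"
        using \<open>0 < u x * u x + (l j)\<^sup>2\<close> by (simp add: v_def powr_minus divide_inverse)
      finally show "x \<in> {x \<in> layer s. 1 / 5 < \<bar>v x\<bar>}"
        using x by (simp add: E_def)
    qed
    note [measurable] = Cc_infinity_borel_measurable[OF v] Cc_infinity_borel_measurable_grad[OF v]
    have "emeasure lborel (E j) \<le> emeasure lborel {x \<in> layer s. 1 / 5 < \<bar>v x\<bar>}"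
      using \<open>E j \<subseteq> _\<close> by (rule emeasure_mono) measurable
    also have "\<dots> \<le> ennreal k *
        (\<integral>\<^sup>+x\<in>layer (3 * s). ennreal (norm (grad v x) powr p) \<partial>lborel)"
      unfolding k_def by (rule weak_layer[OF v s]) simp
    also have "(\<integral>\<^sup>+x\<in>layer (3 * s). ennreal (norm (grad v x) powr p) \<partial>lborel) =
        (\<integral>\<^sup>+x. ennreal (l j powr (-p)) *
          (?t j x * (?g x * indicator (layer (3 * s)) x)) \<partial>lborel)"
      unfolding gv by (simp add: mult.assoc)
    also have "\<dots> = ennreal (l j powr (-p)) *
        (\<integral>\<^sup>+x. ?t j x * (?g x * indicator (layer (3 * s)) x) \<partial>lborel)"
      unfolding h_def by (rule nn_integral_cmult) measurable
    finally have "ennreal (l j powr p) * emeasure lborel (E j) \<le> ennreal (l j powr p) *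
        (ennreal k * (ennreal (l j powr (-p)) *
        (\<integral>\<^sup>+x. ?t j x * (?g x * indicator (layer (3 * s)) x) \<partial>lborel)))"
      by (rule mult_left_mono) simp
    also have "\<dots> = ennreal (l j powr p * l j powr (-p)) * (ennreal k *
        (\<integral>\<^sup>+x. ?t j x * (?g x * indicator (layer (3 * s)) x) \<partial>lborel))"
      by (simp add: ennreal_mult mult_ac)
    also have "l j powr p * l j powr (-p) = 1"
      using l[of j] by (simp add: powr_minus)
    finally show ?thesis by simp
  qed
  have "(\<integral>\<^sup>+x\<in>layer s. ennreal (\<bar>u x\<bar> powr p) \<partial>lborel)
      \<le> (\<integral>\<^sup>+x. (\<Sum>j. ennreal (l j powr p) * indicator (E j) x) \<partial>lborel)"
  proof (rule nn_integral_mono)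
    fix x
    show "ennreal (\<bar>u x\<bar> powr p) * indicator (layer s) x
        \<le> (\<Sum>j. ennreal (l j powr p) * indicator (E j) x)"
    proof (cases "x \<in> layer s \<and> u x \<noteq> 0")
      case True
      \<comment> \<open>For this \<open>j\<close> the single term \<open>l j powr p\<close> already
        dominates the integrand at \<open>x\<close>.\<close>
      then obtain j where "M / 2 ^ Suc j < \<bar>u x\<bar>" and le: "\<bar>u x\<bar> \<le> l j"
        using ex_dyadic[of "\<bar>u x\<bar>" M] M(2) by (auto simp: l_def)
      then have "x \<in> E j"
        using True by (simp add: E_def l_def mult.commute)
      then have "ennreal (\<bar>u x\<bar> powr p) * indicator (layer s) x
          \<le> (\<Sum>i\<in>{j}. ennreal (l i powr p) * indicator (E i) x)"
        using le p True by (auto intro!: ennreal_leI powr_mono2)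
      also have "\<dots> \<le> (\<Sum>j. ennreal (l j powr p) * indicator (E j) x)"
        by (intro sum_le_suminf) auto
      finally show ?thesis .
    qed (use p in auto)
  qed
  also have "\<dots> = (\<Sum>j. \<integral>\<^sup>+x. ennreal (l j powr p) * indicator (E j) x \<partial>lborel)"
    by (rule nn_integral_suminf) measurable
  also have "\<dots> = (\<Sum>j. ennreal (l j powr p) * emeasure lborel (E j))"
    by (simp add: nn_integral_cmult_indicator)
  also have "\<dots> \<le> (\<Sum>j. ennreal k *
      (\<integral>\<^sup>+x. ?t j x * (?g x * indicator (layer (3 * s)) x) \<partial>lborel))"
    by (intro suminf_le level) auto
  also have "\<dots> = ennreal k *
      (\<Sum>j. \<integral>\<^sup>+x. ?t j x * (?g x * indicator (layer (3 * s)) x) \<partial>lborel)"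
    by simp
  also have "(\<Sum>j. \<integral>\<^sup>+x. ?t j x * (?g x * indicator (layer (3 * s)) x) \<partial>lborel)
      = (\<integral>\<^sup>+x. (\<Sum>j. ?t j x * (?g x * indicator (layer (3 * s)) x)) \<partial>lborel)"
    unfolding h_def by (rule nn_integral_suminf[symmetric]) measurable
  also have "\<dots> \<le> (\<integral>\<^sup>+x. ennreal 12 * (?g x * indicator (layer (3 * s)) x) \<partial>lborel)"
  proof (rule nn_integral_mono)
    fix x
    have "(\<Sum>j<n. ?t j x) \<le> ennreal 12" for n
    proof -
      \<comment> \<open>Since \<open>l j = M / 2 ^ j\<close>, the ratios to the levels form the
        dyadic sequence starting at \<open>\<bar>u x\<bar> / M\<close>.\<close>
      have "(\<Sum>j<n. ?t j x) = ennreal (\<Sum>j<n. h (\<bar>u x\<bar> / M * 2 ^ j) powr p)"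
        by (simp add: l_def)
      also have "\<dots> \<le> ennreal 12"
        unfolding h_def using M p
        by (intro ennreal_leI sum_truncation_weight_le) auto
      finally show ?thesis .
    qed
    then have "(\<Sum>j. ?t j x) \<le> ennreal 12"
      by (intro suminf_le_const) auto
    then show "(\<Sum>j. ?t j x * (?g x * indicator (layer (3 * s)) x))
        \<le> ennreal 12 * (?g x * indicator (layer (3 * s)) x)"
      by (simp add: mult_right_mono)
  qed
  also have "\<dots> = ennreal 12 * (\<integral>\<^sup>+x\<in>layer (3 * s). ?g x \<partial>lborel)"
    by (rule nn_integral_cmult) measurable
  finally have "(\<integral>\<^sup>+x\<in>layer s. ennreal (\<bar>u x\<bar> powr p) \<partial>lborel)
      \<le> ennreal k * (ennreal 12 * (\<integral>\<^sup>+x\<in>layer (3 * s). ?g x \<partial>lborel))"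
    by (simp add: mult_left_mono)
  also have "\<dots> = ennreal (k * 12) * (\<integral>\<^sup>+x\<in>layer (3 * s). ?g x \<partial>lborel)"
    using k by (simp add: ennreal_mult mult.assoc)
  also have "k * 12 = layer_const * s powr p"
    using C s by (simp add: k_def layer_const_def powr_mult)
  finally show ?thesis .
qed

section \<open>The Hardy inequality with an additional singular weight\<close>

text \<open>In the factor 6, a 2 comes from \<open>half_powr_le\<close> and a 3 bounds
  \<open>3 powr \<beta>\<close>; \<open>2 powr (p + 1)\<close> bounds
  \<open>2 powr (p + \<beta>)\<close>, the cost of replacing the distance by half the layer
  width.\<close>

definition weighted_const :: real where
  "weighted_const = 6 * 2 powr (p + 1) * layer_const"

lemma weighted_const_pos: "0 < weighted_const"
  using layer_const_pos by (simp add: weighted_const_def)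

text \<open>Apply \<open>strong_layer\<close> at dyadic widths \<open>s i\<close> and sum with the
  weights \<open>(s i / 2) powr (- p - \<beta>)\<close>. The p-th powers of the widths cancel, and
  at a fixed point the remaining \<open>s i powr (- \<beta>)\<close> form a geometric sum, dominated
  by its largest term up to a factor of order \<open>1 / \<beta>\<close>.\<close>

lemma weighted_hardy:
  assumes v: "v \<in> Cc_infinity \<Omega>" and \<beta>: "0 < \<beta>" "\<beta> \<le> 1"
  shows "(\<integral>\<^sup>+x\<in>\<Omega>. ennreal (\<bar>v x\<bar> powr p * d x powr (- p - \<beta>)) \<partial>lborel) \<le>
    ennreal (weighted_const / \<beta>) *
      (\<integral>\<^sup>+x\<in>\<Omega>. ennreal (norm (grad v x) powr p * d x powr (- \<beta>)) \<partial>lborel)"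
proof -
  note [measurable] = Cc_infinity_borel_measurable[OF v] Cc_infinity_borel_measurable_grad[OF v]
  let ?K = "closure {x. v x \<noteq> 0}"
  have "compact (d ` ?K)"
    using v by (intro compact_continuous_image continuous_intros) (auto simp: Cc_infinity_def)
  \<comment> \<open>All distances occurring on the support lie below \<open>D\<close>, so dyadic
    layers starting at \<open>D\<close> reach every point of it.\<close>
  then obtain D where D: "0 < D" "\<And>x. x \<in> ?K \<Longrightarrow> d x \<le> D"
    by (auto dest!: compact_imp_bounded simp: bounded_pos) (use abs_le_D1 in blast)
  define s where "s i = D / 2 ^ i" for i :: nat
  have s: "0 < s i" for i
    using D by (simp add: s_def)
  let ?G = "\<lambda>x. ennreal (norm (grad v x) powr p)"
  let ?I = "\<lambda>i. (\<integral>\<^sup>+x\<in>layer (3 * s i). ?G x \<partial>lborel)"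
  have "(\<integral>\<^sup>+x\<in>\<Omega>. ennreal (\<bar>v x\<bar> powr p * d x powr (- p - \<beta>)) \<partial>lborel)
      \<le> (\<integral>\<^sup>+x. (\<Sum>i. ennreal ((s i / 2) powr (- p - \<beta>)) *
          (ennreal (\<bar>v x\<bar> powr p) * indicator (layer (s i)) x)) \<partial>lborel)"
  proof (rule nn_integral_mono)
    fix x
    let ?f = "\<lambda>i. ennreal ((s i / 2) powr (- p - \<beta>)) *
        (ennreal (\<bar>v x\<bar> powr p) * indicator (layer (s i)) x)"
    show "ennreal (\<bar>v x\<bar> powr p * d x powr (- p - \<beta>)) * indicator \<Omega> x \<le> (\<Sum>i. ?f i)"
    proof (cases "x \<in> \<Omega> \<and> v x \<noteq> 0")
      case True
      then have "x \<in> ?K" "0 < d x"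
        using closure_subset[of "{x. v x \<noteq> 0}"] d_pos by auto
      then obtain i where i: "D / 2 ^ Suc i < d x" "d x \<le> D / 2 ^ i"
        using ex_dyadic D by blast
      then have "x \<in> layer (s i)" "s i / 2 \<le> d x"
        using True by (auto simp: layer_def s_def mult.commute)
      then have "d x powr (- p - \<beta>) \<le> (s i / 2) powr (- p - \<beta>)"
        using s[of i] p \<beta> by (intro powr_mono2') auto
      then have "ennreal (\<bar>v x\<bar> powr p * d x powr (- p - \<beta>)) * indicator \<Omega> x
          \<le> ennreal (\<bar>v x\<bar> powr p * (s i / 2) powr (- p - \<beta>))"
        using True by (auto intro!: ennreal_leI mult_left_mono)
      also have "\<dots> = (\<Sum>i\<in>{i}. ?f i)"
        using \<open>x \<in> layer (s i)\<close> by (simp add: ennreal_mult mult.commute)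
      also have "\<dots> \<le> (\<Sum>i. ?f i)"
        by (intro sum_le_suminf) auto
      finally show ?thesis .
    qed (use p in auto)
  qed
  also have "\<dots> = (\<Sum>i. \<integral>\<^sup>+x. ennreal ((s i / 2) powr (- p - \<beta>)) *
      (ennreal (\<bar>v x\<bar> powr p) * indicator (layer (s i)) x) \<partial>lborel)"
    by (rule nn_integral_suminf) measurable
  also have "\<dots> = (\<Sum>i. ennreal ((s i / 2) powr (- p - \<beta>)) *
      (\<integral>\<^sup>+x\<in>layer (s i). ennreal (\<bar>v x\<bar> powr p) \<partial>lborel))"
    by (intro suminf_cong nn_integral_cmult) measurable
  also have "\<dots> \<le> (\<Sum>i. ennreal ((s i / 2) powr (- p - \<beta>)) *
      (ennreal (layer_const * s i powr p) * ?I i))"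
    by (intro suminf_le mult_left_mono strong_layer v s) auto
  also have "\<dots> = (\<Sum>i. ennreal (2 powr (p + \<beta>) * layer_const) *
      (ennreal (s i powr (- \<beta>)) * ?I i))"
  proof (intro suminf_cong)
    fix i
    have eq: "(s i / 2) powr (- p - \<beta>) * (layer_const * s i powr p)
        = 2 powr (p + \<beta>) * layer_const * s i powr (- \<beta>)"
      using s[of i] by (simp add: powr_divide powr_diff powr_minus powr_add field_simps)
    have "ennreal ((s i / 2) powr (- p - \<beta>)) * ennreal (layer_const * s i powr p)
        = ennreal (2 powr (p + \<beta>) * layer_const) * ennreal (s i powr (- \<beta>))"
      using layer_const_pos by (subst (1 2) ennreal_mult[symmetric]) (simp_all only: eq, simp_all)
    then show "ennreal ((s i / 2) powr (- p - \<beta>)) * (ennreal (layer_const * s i powr p) * ?I i)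
        = ennreal (2 powr (p + \<beta>) * layer_const) * (ennreal (s i powr (- \<beta>)) * ?I i)"
      by (simp only: mult.assoc[symmetric])
  qed
  also have "\<dots> = ennreal (2 powr (p + \<beta>) * layer_const) *
      (\<Sum>i. ennreal (s i powr (- \<beta>)) * ?I i)"
    by simp
  also have "(\<Sum>i. ennreal (s i powr (- \<beta>)) * ?I i)
      = (\<Sum>i. \<integral>\<^sup>+x. ennreal (s i powr (- \<beta>)) * (?G x * indicator (layer (3 * s i)) x) \<partial>lborel)"
    by (intro suminf_cong nn_integral_cmult[symmetric]) measurable
  also have "\<dots> = (\<integral>\<^sup>+x. (\<Sum>i. ennreal (s i powr (- \<beta>)) *
      (?G x * indicator (layer (3 * s i)) x)) \<partial>lborel)"
    by (rule nn_integral_suminf[symmetric]) measurable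
  also have "\<dots> \<le> (\<integral>\<^sup>+x. ennreal (6 / \<beta>) *
      (ennreal (norm (grad v x) powr p * d x powr (- \<beta>)) * indicator \<Omega> x) \<partial>lborel)"
  proof (rule nn_integral_mono)
    fix x
    show "(\<Sum>i. ennreal (s i powr (- \<beta>)) * (?G x * indicator (layer (3 * s i)) x)) \<le>
        ennreal (6 / \<beta>) * (ennreal (norm (grad v x) powr p * d x powr (- \<beta>)) * indicator \<Omega> x)"
    proof (cases "x \<in> \<Omega>")
      case True
      then have dx: "0 < d x" by (rule d_pos)
      define a where "a i = (if d x \<le> 3 * s i then s i powr (- \<beta>) else 0)" for i
      have "(\<Sum>i<n. ennreal (a i)) \<le> ennreal (6 / \<beta> * d x powr (- \<beta>))" for n
      proof -
        \<comment> \<open>The condition \<open>d x \<le> 3 * s i\<close> implies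
          \<open>s i powr (- \<beta>) \<le> b\<close>, which turns the sum into the truncated
          geometric one of ratio \<open>q\<close>.\<close>
        define q where "q = 2 powr \<beta>"
        define b where "b = (d x / 3) powr (- \<beta>)"
        have q: "1 < q"
          using \<beta> by (simp add: q_def)
        have sq: "s i powr (- \<beta>) = D powr (- \<beta>) * q ^ i" for i
        proof -
          have "s i = D * 2 powr (- real i)"
            by (simp add: s_def powr_minus powr_realpow divide_inverse)
          then show ?thesis
            using D by (simp add: q_def powr_mult powr_powr powr_power mult.commute)
        qed
        have "a i \<le> (if D powr (- \<beta>) * q ^ i \<le> b then D powr (- \<beta>) * q ^ i else 0)" for i
        proof (cases "d x \<le> 3 * s i")
          case True
          then have "s i powr (- \<beta>) \<le> b"
            unfolding b_def using dx \<beta> by (intro powr_mono2') auto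
          then show ?thesis
            using True by (simp add: a_def sq)
        qed (use q in \<open>simp add: a_def\<close>)
        then have "(\<Sum>i<n. a i) * (q - 1) \<le>
            (\<Sum>i<n. if D powr (- \<beta>) * q ^ i \<le> b then D powr (- \<beta>) * q ^ i else 0) * (q - 1)"
          using q by (intro mult_right_mono sum_mono) auto
        also have "\<dots> \<le> q * b"
          using q by (intro sum_truncated_geometric_le) (auto simp: b_def)
        finally have le: "(\<Sum>i<n. a i) * (q - 1) \<le> q * b" .
        \<comment> \<open>Replaces the geometric factor \<open>q / (q - 1)\<close> by
          \<open>2 / \<beta>\<close>.\<close>
        have "q * \<beta> \<le> 2 * (q - 1)"
          using half_powr_le[OF \<beta>] by (simp add: q_def mult.commute)
        then have "q * \<beta> * b \<le> 2 * (q - 1) * b"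
          by (intro mult_right_mono) (auto simp: b_def)
        moreover have "(\<Sum>i<n. a i) * (q - 1) * \<beta> \<le> q * b * \<beta>"
          using le \<beta> by (intro mult_right_mono) auto
        ultimately have "((\<Sum>i<n. a i) * \<beta>) * (q - 1) \<le> (2 * b) * (q - 1)"
          by (simp add: mult_ac)
        then have "(\<Sum>i<n. a i) * \<beta> \<le> 2 * b"
          using q by simp
        also have "b = 3 powr \<beta> * d x powr (- \<beta>)"
          using dx by (simp add: b_def powr_divide powr_minus field_simps)
        also have "2 * (3 powr \<beta> * d x powr (- \<beta>)) \<le> 6 * d x powr (- \<beta>)"
        proof -
          have "3 powr \<beta> \<le> 3 powr (1::real)"
            using \<beta> by (intro powr_mono) auto
          then show ?thesis by (simp add: mult_right_mono)
        qed
        finally have "(\<Sum>i<n. a i) \<le> 6 / \<beta> * d x powr (- \<beta>)"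
          using \<beta> by (simp add: field_simps)
        then show ?thesis
          by (subst sum_ennreal) (auto simp: a_def intro: ennreal_leI)
      qed
      then have sum: "(\<Sum>i. ennreal (a i)) \<le> ennreal (6 / \<beta> * d x powr (- \<beta>))"
        by (intro suminf_le_const) auto
      have "(\<Sum>i. ennreal (s i powr (- \<beta>)) * (?G x * indicator (layer (3 * s i)) x))
          = (\<Sum>i. ennreal (a i) * ?G x)"
        using True by (intro suminf_cong) (auto simp: a_def layer_def)
      also have "\<dots> = (\<Sum>i. ennreal (a i)) * ?G x"
        by simp
      also have "\<dots> \<le> ennreal (6 / \<beta> * d x powr (- \<beta>)) * ?G x"
        by (intro mult_right_mono sum) auto
      also have "\<dots> = ennreal (6 / \<beta>) * ennreal (norm (grad v x) powr p * d x powr (- \<beta>))"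
        using \<beta> by (simp add: mult_ac flip: ennreal_mult)
      finally show ?thesis
        using True by simp
    qed (simp add: layer_def)
  qed
  also have "\<dots> = ennreal (6 / \<beta>) *
      (\<integral>\<^sup>+x\<in>\<Omega>. ennreal (norm (grad v x) powr p * d x powr (- \<beta>)) \<partial>lborel)"
    by (rule nn_integral_cmult) measurable
  finally have "(\<integral>\<^sup>+x\<in>\<Omega>. ennreal (\<bar>v x\<bar> powr p * d x powr (- p - \<beta>)) \<partial>lborel)
      \<le> ennreal (2 powr (p + \<beta>) * layer_const) * (ennreal (6 / \<beta>) *
        (\<integral>\<^sup>+x\<in>\<Omega>. ennreal (norm (grad v x) powr p * d x powr (- \<beta>)) \<partial>lborel))"
    by (simp add: mult_left_mono)
  also have "\<dots> = ennreal (2 powr (p + \<beta>) * layer_const * (6 / \<beta>)) *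
      (\<integral>\<^sup>+x\<in>\<Omega>. ennreal (norm (grad v x) powr p * d x powr (- \<beta>)) \<partial>lborel)"
    using \<beta> layer_const_pos by (simp only: mult.assoc[symmetric]) (simp flip: ennreal_mult)
  also have "\<dots> \<le> ennreal (weighted_const / \<beta>) *
      (\<integral>\<^sup>+x\<in>\<Omega>. ennreal (norm (grad v x) powr p * d x powr (- \<beta>)) \<partial>lborel)"
  proof (intro mult_right_mono ennreal_leI)
    have "2 powr (p + \<beta>) \<le> 2 powr (p + 1)"
      using \<beta> by (intro powr_mono) auto
    then show "2 powr (p + \<beta>) * layer_const * (6 / \<beta>) \<le> weighted_const / \<beta>"
      using \<beta> layer_const_pos by (simp add: weighted_const_def divide_right_mono mult_ac)
  qed simp
  finally show ?thesis .
qed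

section \<open>A smooth substitute for powers of the distance\<close>

text \<open>A nearest boundary point of \<open>x\<close> satisfies the strict form of the inequality
  because \<open>d x\<close> is positive; strictness makes the sets \<open>U y\<close> open, and
  compactness extracts finitely many of them.\<close>

lemma ex_finite_net:
  assumes "compact K" "K \<subseteq> \<Omega>"
  obtains Y where "finite Y" "Y \<noteq> {}" "Y \<subseteq> frontier \<Omega>" "\<And>x. x \<in> K \<Longrightarrow> \<exists>y\<in>Y. dist x y \<le> 2 * d x"
proof -
  define U where "U y = {x. dist x y < 2 * d x}" for y
  have "open (U y)" for y
    unfolding U_def by (intro open_Collect_less continuous_intros)
  moreover have "K \<subseteq> (\<Union>y\<in>frontier \<Omega>. U y)"
  proof
    fix x assume "x \<in> K"
    then have "0 < d x"
      using assms d_pos by auto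
    moreover obtain y where "y \<in> frontier \<Omega>" "d x = dist x y"
      using infdist_attains_inf[OF frontier_closed frontier_nonempty] by metis
    ultimately have "dist x y < 2 * d x" "y \<in> frontier \<Omega>"
      by linarith+
    then show "x \<in> (\<Union>y\<in>frontier \<Omega>. U y)"
      by (auto simp: U_def)
  qed
  ultimately obtain Z where Z: "Z \<subseteq> frontier \<Omega>" "finite Z" "K \<subseteq> (\<Union>y\<in>Z. U y)"
    using compactE_image[OF assms(1), of "frontier \<Omega>" U] by metis
  obtain y0 where y0: "y0 \<in> frontier \<Omega>"
    using frontier_nonempty by blast
  show thesis
  \<comment> \<open>The extra point \<open>y0\<close> keeps the net nonempty even if
    \<open>K\<close> is empty.\<close>
  proof (rule that[of "insert y0 Z"])
    fix x assume "x \<in> K"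
    then show "\<exists>y\<in>insert y0 Z. dist x y \<le> 2 * d x"
      using Z(3) by (force simp: U_def)
  qed (use Z y0 in auto)
qed

text \<open>The weight is a smooth substitute for \<open>d powr \<gamma>\<close>: an \<open>\<ell>\<^sup>p\<close>-type soft minimum of the distances
  to finitely many boundary points, raised to the power \<open>\<gamma>\<close>. The inner exponent \<open>m\<close> is so large that
  the number of points costs at most a factor 2.\<close>

lemma ex_smooth_weight:
  assumes K: "compact K" "K \<subseteq> \<Omega>" and \<gamma>: "0 < \<gamma>"
  obtains w where "\<And>k. Ck_on k \<Omega> w" "\<And>x. x \<in> \<Omega> \<Longrightarrow> 0 < w x"
    "\<And>x. x \<in> \<Omega> \<Longrightarrow> d x powr \<gamma> / 2 \<le> w x"
    "\<And>x. x \<in> K \<Longrightarrow> w x \<le> (2 * d x) powr \<gamma>"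
    "\<And>x. x \<in> \<Omega> \<Longrightarrow> norm (grad w x) \<le> \<gamma> * w x / d x"
proof -
  obtain Y where Y: "finite Y" "Y \<noteq> {}" "Y \<subseteq> frontier \<Omega>"
      and net: "\<And>x. x \<in> K \<Longrightarrow> \<exists>y\<in>Y. dist x y \<le> 2 * d x"
    using ex_finite_net[OF K] by metis
  \<comment> \<open>The outer exponent is one over the number of points, since
    \<open>card Y powr (1 / card Y)\<close> is at most 2; \<open>m\<close> is then fixed by
    \<open>2 * a * m = \<gamma>\<close>, which gives \<open>w\<close> the homogeneity of
    \<open>d powr \<gamma>\<close>.\<close>
  define a where "a = 1 / real (card Y)"
  define m where "m = \<gamma> / (2 * a)"
  have cY: "0 < real (card Y)"
    using Y by (simp add: card_gt_0_iff)
  have a: "0 < a" and m: "0 < m" and am: "2 * a * m = \<gamma>"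
    using cY \<gamma> by (auto simp: a_def m_def)
  define q where "q y x = inner (x - y) (x - y)" for x y :: 'a
  define S where "S x = (\<Sum>y\<in>Y. q y x powr (-m))" for x
  define w where "w x = S x powr (-a)" for x
  have dle: "d x \<le> dist x y" if "y \<in> Y" for x y
    using that Y by (intro infdist_le) auto
  have q_eq: "q y x = (dist x y)\<^sup>2" for x y
    by (simp add: q_def dist_norm power2_norm_eq_inner)
  have qpow: "q y x powr b = dist x y powr (2 * b)" if "x \<in> \<Omega>" "y \<in> Y" for x y b
    using dle[OF that(2), of x] d_pos[OF that(1)]
    by (simp add: q_eq powr_powr flip: powr_numeral)
  have q_pos: "0 < q y x" if "x \<in> \<Omega>" "y \<in> Y" for x y
    using dle[OF that(2), of x] d_pos[OF that(1)] unfolding q_eq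
    by (intro zero_less_power) linarith
  have S_pos: "0 < S x" if "x \<in> \<Omega>" for x
    unfolding S_def using Y(1,2)
    by (rule sum_pos) (metis less_irrefl powr_gt_zero q_pos that)
  have S_upper: "S x \<le> card Y * d x powr (-2 * m)" if x: "x \<in> \<Omega>" for x
  proof -
    have "S x \<le> (\<Sum>y\<in>Y. d x powr (-2 * m))"
      unfolding S_def
    proof (rule sum_mono)
      fix y assume "y \<in> Y"
      then show "q y x powr (-m) \<le> d x powr (-2 * m)"
        using dle[of y x] d_pos[OF x] m by (simp add: qpow[OF x]) (intro powr_mono2', auto)
    qed
    then show ?thesis by simp
  qed
  have smooth: "Ck_on k \<Omega> w" for k
  proof -
    have "Ck_on k \<Omega> (q y)" for y
      unfolding q_def[abs_def] by (rule Ck_on_inner_diff_self[OF open_\<Omega>])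
    then have "Ck_on k \<Omega> S"
      unfolding S_def[abs_def] using q_pos by (intro Ck_on_sum Ck_on_powr open_\<Omega>)
    then show ?thesis
      unfolding w_def[abs_def] using S_pos by (rule Ck_on_powr[OF open_\<Omega>])
  qed
  have lower: "d x powr \<gamma> / 2 \<le> w x" if x: "x \<in> \<Omega>" for x
  proof -
    have "real (card Y) \<le> 2 ^ card Y"
      by (simp add: less_imp_le of_nat_less_two_power)
    then have "real (card Y) powr a \<le> (2 powr card Y) powr a"
      using a by (intro powr_mono2) (auto simp: powr_realpow)
    also have "\<dots> = 2"
      using cY by (simp add: powr_powr a_def)
    finally have "real (card Y) powr a \<le> 2" .
    then have "1 / 2 \<le> real (card Y) powr (-a)"
      using cY by (simp add: powr_minus_divide field_simps)
    then have "d x powr \<gamma> / 2 \<le> real (card Y) powr (-a) * d x powr \<gamma>"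
      using mult_right_mono[of "1 / 2" "real (card Y) powr (-a)" "d x powr \<gamma>"] by simp
    also have "\<dots> = (card Y * d x powr (-2 * m)) powr (-a)"
      using am by (simp add: powr_mult powr_powr mult.commute mult.left_commute)
    also have "\<dots> \<le> w x"
      unfolding w_def using S_upper[OF x] S_pos[OF x] a by (intro powr_mono2') auto
    finally show ?thesis .
  qed
  have upper: "w x \<le> (2 * d x) powr \<gamma>" if x: "x \<in> K" for x
  proof -
    have "x \<in> \<Omega>" using x K by auto
    obtain y where y: "y \<in> Y" "dist x y \<le> 2 * d x"
      using net[OF x] by blast
    \<comment> \<open>One term of \<open>S\<close> coming from the net suffices, which is why the
      upper bound is restricted to \<open>K\<close>.\<close>
    have "(2 * d x) powr (-2 * m) \<le> dist x y powr (-2 * m)"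
      using y dle[OF y(1), of x] d_pos[OF \<open>x \<in> \<Omega>\<close>] m by (intro powr_mono2') auto
    also have "\<dots> = q y x powr (-m)"
      using qpow[OF \<open>x \<in> \<Omega>\<close> y(1), of "-m"] by simp
    also have "\<dots> \<le> S x"
      unfolding S_def using Y y by (intro member_le_sum) auto
    finally have "w x \<le> ((2 * d x) powr (-2 * m)) powr (-a)"
      unfolding w_def using a d_pos[OF \<open>x \<in> \<Omega>\<close>] by (intro powr_mono2') auto
    also have "\<dots> = (2 * d x) powr \<gamma>"
      using am by (simp add: powr_powr mult.commute mult.left_commute)
    finally show ?thesis .
  qed
  \<comment> \<open>Each summand of \<open>S\<close> has logarithmic gradient at most
    \<open>2 * m / d x\<close>, hence so has \<open>S\<close>; the outer power multiplies this by
    \<open>a\<close>. The number of points drops out because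
    \<open>2 * a * m = \<gamma>\<close>.\<close>
  have gradw: "norm (grad w x) \<le> \<gamma> * w x / d x" if x: "x \<in> \<Omega>" for x
  proof -
    have dq: "GDERIV (q y) x :> 2 *\<^sub>R (x - y)" for y
      unfolding q_def[abs_def] gderiv_def
      by (auto intro!: derivative_eq_intros simp: inner_commute)
    have "GDERIV (\<lambda>x. q y x powr (-m)) x :> (- m * q y x powr (- m - 1)) *\<^sub>R (2 *\<^sub>R (x - y))"
      if "y \<in> Y" for y
      by (rule GDERIV_DERIV_compose[OF dq]) (rule has_real_derivative_powr[OF q_pos[OF x that]])
    then have "GDERIV S x :> (\<Sum>y\<in>Y. (- m * q y x powr (- m - 1)) *\<^sub>R (2 *\<^sub>R (x - y)))"
      unfolding S_def[abs_def] gderiv_def inner_sum_right by (rule has_derivative_sum)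
    then have "GDERIV w x :> (- a * S x powr (- a - 1)) *\<^sub>R
        (\<Sum>y\<in>Y. (- m * q y x powr (- m - 1)) *\<^sub>R (2 *\<^sub>R (x - y)))"
      unfolding w_def[abs_def] by (rule GDERIV_DERIV_compose) (rule has_real_derivative_powr[OF S_pos[OF x]])
    then have "norm (grad w x) = a * S x powr (- a - 1) *
        norm (\<Sum>y\<in>Y. (- m * q y x powr (- m - 1)) *\<^sub>R (2 *\<^sub>R (x - y)))"
      using a by (simp add: grad_eqI)
    also have "\<dots> \<le> a * S x powr (- a - 1) * (\<Sum>y\<in>Y. 2 * m / d x * q y x powr (-m))"
    proof (intro mult_left_mono order_trans[OF norm_sum] sum_mono)
      fix y assume y: "y \<in> Y"
      have "dist x y > 0"
        using dle[OF y, of x] d_pos[OF x] by linarith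
      have "q y x powr (- m - 1) * norm (x - y) = q y x powr (-m) / dist x y"
        using \<open>dist x y > 0\<close> q_pos[OF x y]
        by (simp add: powr_diff q_eq[of y x] dist_norm power2_eq_square)
      also have "\<dots> \<le> q y x powr (-m) / d x"
        using dle[OF y, of x] d_pos[OF x] \<open>dist x y > 0\<close>
        by (intro divide_left_mono mult_pos_pos) auto
      finally have "2 * m * (q y x powr (- m - 1) * norm (x - y)) \<le> 2 * m * (q y x powr (-m) / d x)"
        using m by (intro mult_left_mono) auto
      then show "norm ((- m * q y x powr (- m - 1)) *\<^sub>R (2 *\<^sub>R (x - y)))
          \<le> 2 * m / d x * q y x powr (-m)"
        using m by (simp add: abs_mult mult_ac)
    qed (use a in auto)
    also have "\<dots> = a * S x powr (- a - 1) * (2 * m / d x * S x)"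
      by (simp add: S_def sum_distrib_left)
    also have "\<dots> = (2 * a * m) * (S x powr (- a - 1) * S x) / d x"
      by simp
    also have "S x powr (- a - 1) * S x = w x"
      using S_pos[OF x] by (simp add: w_def powr_diff)
    finally show ?thesis
      by (simp only: am)
  qed
  have "0 < w x" if "x \<in> \<Omega>" for x
    using S_pos[OF that] by (simp add: w_def)
  with smooth show thesis
    using lower upper gradw by (rule that)
qed

section \<open>Removing the weight and absorbing the error\<close>

text \<open>\<open>weighted_hardy\<close> is applied to \<open>v = u * w\<close> with
  \<open>\<gamma> = \<beta> / p\<close>, so that \<open>w powr p\<close> is comparable to
  \<open>d powr \<beta>\<close> on the support and cancels the weight. The derivative falling on
  \<open>w\<close> produces the error. In \<open>B\<close>, the first power of 2 comes from the
  lower bound on \<open>w\<close>, the last from splitting the gradient and from the upper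
  bound.\<close>

lemma hardy_with_error_term:
  assumes u: "u \<in> Cc_infinity \<Omega>" and \<beta>: "0 < \<beta>" "\<beta> \<le> 1"
  defines "B \<equiv> 2 powr p * weighted_const * 2 powr (p + 1)"
  shows "(\<integral>\<^sup>+x\<in>\<Omega>. ennreal (\<bar>u x\<bar> powr p / d x powr p) \<partial>lborel) \<le>
    ennreal (B / \<beta>) * ((\<integral>\<^sup>+x\<in>\<Omega>. ennreal (norm (grad u x) powr p) \<partial>lborel) +
      ennreal ((\<beta> / p) powr p) * (\<integral>\<^sup>+x\<in>\<Omega>. ennreal (\<bar>u x\<bar> powr p / d x powr p) \<partial>lborel))"
proof -
  note [measurable] = Cc_infinity_borel_measurable[OF u] Cc_infinity_borel_measurable_grad[OF u]
  define \<gamma> where "\<gamma> = \<beta> / p"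
  have \<gamma>: "0 < \<gamma>" "\<gamma> * p = \<beta>"
    using \<beta> p by (auto simp: \<gamma>_def)
  let ?K = "closure {x. u x \<noteq> 0}"
  have K: "compact ?K" "?K \<subseteq> \<Omega>"
    using u by (auto simp: Cc_infinity_def)
  obtain w where smooth: "\<And>k. Ck_on k \<Omega> w" and w_pos: "\<And>x. x \<in> \<Omega> \<Longrightarrow> 0 < w x"
    and lower: "\<And>x. x \<in> \<Omega> \<Longrightarrow> d x powr \<gamma> / 2 \<le> w x"
    and upper: "\<And>x. x \<in> ?K \<Longrightarrow> w x \<le> (2 * d x) powr \<gamma>"
    and gradw: "\<And>x. x \<in> \<Omega> \<Longrightarrow> norm (grad w x) \<le> \<gamma> * w x / d x"
    using ex_smooth_weight[OF K \<gamma>(1)] by metis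
  define v where "v x = u x * w x" for x
  have v: "v \<in> Cc_infinity \<Omega>"
    unfolding v_def[abs_def] by (rule Cc_infinity_mult[OF u open_\<Omega> smooth])
  note [measurable] = Cc_infinity_borel_measurable[OF v] Cc_infinity_borel_measurable_grad[OF v]
  have assoc: "ennreal a * (ennreal b * (ennreal c * X)) = ennreal (a * b * c) * X"
    if "0 \<le> a" "0 \<le> b" "0 \<le> c" for a b c X
    using that by (simp add: ennreal_mult mult.assoc)
  let ?f = "\<lambda>x. ennreal (\<bar>u x\<bar> powr p / d x powr p) * indicator \<Omega> x"
  let ?g = "\<lambda>x. ennreal (norm (grad u x) powr p) * indicator \<Omega> x"
  have "(\<integral>\<^sup>+x. ?f x \<partial>lborel) \<le> (\<integral>\<^sup>+x. ennreal (2 powr p) *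
      (ennreal (\<bar>v x\<bar> powr p * d x powr (- p - \<beta>)) * indicator \<Omega> x) \<partial>lborel)"
  proof (intro nn_integral_mono)
    fix x
    have "\<bar>u x\<bar> powr p / d x powr p \<le> 2 powr p * (\<bar>v x\<bar> powr p * d x powr (- p - \<beta>))"
      if x: "x \<in> \<Omega>"
    proof -
      have "\<bar>u x\<bar> * d x powr \<gamma> \<le> 2 * \<bar>v x\<bar>"
        using mult_left_mono[OF lower[OF x], of "\<bar>u x\<bar>"] w_pos[OF x] by (simp add: v_def abs_mult)
      then have "(\<bar>u x\<bar> * d x powr \<gamma>) powr p \<le> (2 * \<bar>v x\<bar>) powr p"
        using p by (intro powr_mono2) auto
      then have "\<bar>u x\<bar> powr p * d x powr \<beta> \<le> 2 powr p * \<bar>v x\<bar> powr p"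
        by (simp add: powr_mult powr_powr \<gamma>)
      then have "\<bar>u x\<bar> powr p * d x powr \<beta> * d x powr (- p - \<beta>)
          \<le> 2 powr p * \<bar>v x\<bar> powr p * d x powr (- p - \<beta>)"
        by (intro mult_right_mono) auto
      moreover have "d x powr \<beta> * d x powr (- p - \<beta>) = 1 / d x powr p"
        using d_pos[OF x] by (simp add: powr_add[symmetric] powr_minus_divide)
      ultimately show ?thesis
        by (simp add: mult.assoc)
    qed
    then show "?f x \<le> ennreal (2 powr p) *
        (ennreal (\<bar>v x\<bar> powr p * d x powr (- p - \<beta>)) * indicator \<Omega> x)"
      by (auto simp flip: ennreal_mult intro: ennreal_leI split: split_indicator)
  qed
  also have "\<dots> = ennreal (2 powr p) *
      (\<integral>\<^sup>+x\<in>\<Omega>. ennreal (\<bar>v x\<bar> powr p * d x powr (- p - \<beta>)) \<partial>lborel)"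
    by (rule nn_integral_cmult) measurable
  also have "\<dots> \<le> ennreal (2 powr p) * (ennreal (weighted_const / \<beta>) *
      (\<integral>\<^sup>+x\<in>\<Omega>. ennreal (norm (grad v x) powr p * d x powr (- \<beta>)) \<partial>lborel))"
    by (intro mult_left_mono weighted_hardy v \<beta>) auto
  also have "(\<integral>\<^sup>+x\<in>\<Omega>. ennreal (norm (grad v x) powr p * d x powr (- \<beta>)) \<partial>lborel)
      \<le> (\<integral>\<^sup>+x. ennreal (2 powr (p + 1)) * (?g x + ennreal (\<gamma> powr p) * ?f x) \<partial>lborel)"
  proof (intro nn_integral_mono)
    fix x
    have "norm (grad v x) powr p * d x powr (- \<beta>)
        \<le> 2 powr (p + 1) * (norm (grad u x) powr p + \<gamma> powr p * (\<bar>u x\<bar> powr p / d x powr p))"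
      (is "?l \<le> ?r") if x: "x \<in> \<Omega>"
    \<comment> \<open>The upper bound on \<open>w\<close> holds on the support of \<open>u\<close>
      only; off it, \<open>v\<close> vanishes near \<open>x\<close> and so does its
      gradient.\<close>
    proof (cases "x \<in> ?K")
      case False
      moreover have "closure {x. v x \<noteq> 0} \<subseteq> ?K"
        by (rule closure_mono) (auto simp: v_def)
      ultimately have "grad v x = 0"
        by (intro grad_eq_0) blast
      then show ?thesis using p by simp
    next
      case True
      have dx: "0 < d x" by (rule d_pos[OF x])
      have "GDERIV v x :> u x *\<^sub>R grad w x + w x *\<^sub>R grad u x"
        unfolding v_def
        by (intro GDERIV_mult GDERIV_grad Cc_infinity_differentiable[OF u])
          (use smooth[of 1] x in auto)
      then have "norm (grad v x) \<le> \<bar>u x\<bar> * norm (grad w x) + w x * norm (grad u x)"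
        using norm_triangle_ineq[of "u x *\<^sub>R grad w x" "w x *\<^sub>R grad u x"] w_pos[OF x]
        by (simp add: grad_eqI)
      also have "\<dots> \<le> \<bar>u x\<bar> * (\<gamma> * w x / d x) + w x * norm (grad u x)"
        using gradw[OF x] by (intro add_right_mono mult_left_mono) auto
      also have "\<dots> = w x * (norm (grad u x) + \<gamma> * (\<bar>u x\<bar> / d x))"
        by (simp add: field_simps)
      also have "\<dots> \<le> (2 * d x) powr \<gamma> * (norm (grad u x) + \<gamma> * (\<bar>u x\<bar> / d x))"
        using \<gamma> dx by (intro mult_right_mono upper True) auto
      finally have "norm (grad v x) powr p
          \<le> ((2 * d x) powr \<gamma> * (norm (grad u x) + \<gamma> * (\<bar>u x\<bar> / d x))) powr p"
        using p by (intro powr_mono2) auto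
      also have "\<dots> = (2 * d x) powr \<beta> * (norm (grad u x) + \<gamma> * (\<bar>u x\<bar> / d x)) powr p"
        using dx \<gamma> by (simp add: powr_mult powr_powr)
      also have "\<dots> \<le> (2 * d x) powr \<beta> *
          (2 powr p * (norm (grad u x) powr p + (\<gamma> * (\<bar>u x\<bar> / d x)) powr p))"
        using dx \<gamma> p by (intro mult_left_mono powr_add_le) auto
      finally have "?l \<le> (2 * d x) powr \<beta> *
          (2 powr p * (norm (grad u x) powr p + (\<gamma> * (\<bar>u x\<bar> / d x)) powr p)) * d x powr (- \<beta>)"
        by (rule mult_right_mono) simp
      also have "\<dots> = 2 powr (p + \<beta>) *
          (norm (grad u x) powr p + \<gamma> powr p * (\<bar>u x\<bar> powr p / d x powr p))"
        using dx \<gamma> by (simp add: powr_mult powr_divide powr_minus powr_add)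
      also have "\<dots> \<le> ?r"
        using \<beta> dx by (intro mult_right_mono powr_mono) auto
      finally show ?thesis .
    qed
    then show "ennreal (norm (grad v x) powr p * d x powr (- \<beta>)) * indicator \<Omega> x
        \<le> ennreal (2 powr (p + 1)) * (?g x + ennreal (\<gamma> powr p) * ?f x)"
      by (auto simp flip: ennreal_mult ennreal_plus intro: ennreal_leI split: split_indicator)
  qed
  also have "\<dots> = ennreal (2 powr (p + 1)) * (\<integral>\<^sup>+x. ?g x + ennreal (\<gamma> powr p) * ?f x \<partial>lborel)"
    by (rule nn_integral_cmult) measurable
  also have "(\<integral>\<^sup>+x. ?g x + ennreal (\<gamma> powr p) * ?f x \<partial>lborel)
      = (\<integral>\<^sup>+x. ?g x \<partial>lborel) + (\<integral>\<^sup>+x. ennreal (\<gamma> powr p) * ?f x \<partial>lborel)"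
    by (rule nn_integral_add) measurable
  also have "(\<integral>\<^sup>+x. ennreal (\<gamma> powr p) * ?f x \<partial>lborel)
      = ennreal (\<gamma> powr p) * (\<integral>\<^sup>+x. ?f x \<partial>lborel)"
    by (rule nn_integral_cmult) measurable
  finally have "(\<integral>\<^sup>+x. ?f x \<partial>lborel) \<le> ennreal (2 powr p) * (ennreal (weighted_const / \<beta>) *
      (ennreal (2 powr (p + 1)) * ((\<integral>\<^sup>+x. ?g x \<partial>lborel) +
        ennreal (\<gamma> powr p) * (\<integral>\<^sup>+x. ?f x \<partial>lborel))))"
    by (simp add: mult_left_mono)
  also have "\<dots> = ennreal (2 powr p * (weighted_const / \<beta>) * 2 powr (p + 1)) *
      ((\<integral>\<^sup>+x. ?g x \<partial>lborel) + ennreal (\<gamma> powr p) * (\<integral>\<^sup>+x. ?f x \<partial>lborel))"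
    using weighted_const_pos \<beta> by (intro assoc) auto
  also have "2 powr p * (weighted_const / \<beta>) * 2 powr (p + 1) = B / \<beta>"
    by (simp add: B_def)
  finally show ?thesis
    by (simp add: \<gamma>_def)
qed

text \<open>Absorbing the error means subtracting a multiple of the left side, which requires
  finiteness. On the compact support the distance is positive, so the integrand is continuous there
  and hence bounded.\<close>

lemma hardy_integral_finite:
  assumes u: "u \<in> Cc_infinity \<Omega>"
  shows "(\<integral>\<^sup>+x\<in>\<Omega>. ennreal (\<bar>u x\<bar> powr p / d x powr p) \<partial>lborel) < \<infinity>"
proof -
  let ?K = "closure {x. u x \<noteq> 0}"
  let ?f = "\<lambda>x. \<bar>u x\<bar> powr p / d x powr p"
  have K: "compact ?K" "?K \<subseteq> \<Omega>"
    using u by (auto simp: Cc_infinity_def)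
  have "continuous_on ?K u"
    using Cc_infinity_continuous[OF u] by (rule continuous_on_subset) simp
  then have "continuous_on ?K ?f"
    using p K d_pos by (intro continuous_intros continuous_on_powr') force+
  then have "bounded (?f ` ?K)"
    using K by (intro compact_imp_bounded compact_continuous_image)
  then obtain b where b: "0 < b" "\<And>x. x \<in> ?K \<Longrightarrow> ?f x \<le> b"
    by (auto simp: bounded_pos)
  have "(\<integral>\<^sup>+x\<in>\<Omega>. ennreal (?f x) \<partial>lborel) \<le> (\<integral>\<^sup>+x. ennreal b * indicator ?K x \<partial>lborel)"
  proof (rule nn_integral_mono)
    fix x
    show "ennreal (?f x) * indicator \<Omega> x \<le> ennreal b * indicator ?K x"
    proof (cases "x \<in> ?K")
      case True
      then show ?thesis
        using b(2)[OF True] by (auto intro: ennreal_leI split: split_indicator)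
    next
      case False
      then have "u x = 0"
        using closure_subset[of "{x. u x \<noteq> 0}"] by auto
      then show ?thesis using p by simp
    qed
  qed
  also have "\<dots> = ennreal b * emeasure lborel ?K"
    by (rule nn_integral_cmult_indicator) simp
  also have "\<dots> < \<infinity>"
    using emeasure_compact_finite[OF K(1)] by (simp add: ennreal_mult_less_top)
  finally show ?thesis .
qed

text \<open>The error coefficient is a constant times \<open>\<beta> powr (p - 1)\<close>, which
  tends to 0 with \<open>\<beta>\<close> because \<open>p > 1\<close>; once it is at most one half,
  the error is absorbed.\<close>

lemma integral_hardy: "integral_hardy p \<Omega>"
proof -
  define B where "B = 2 powr p * weighted_const * 2 powr (p + 1)"
  have B: "0 < B"
    using weighted_const_pos by (simp add: B_def)
  \<comment> \<open>The second argument of \<open>min\<close> solves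
    \<open>B / p powr p * \<beta> powr (p - 1) = 1 / 2\<close>; the first ensures
    \<open>\<beta> \<le> 1\<close>.\<close>
  define \<beta> where "\<beta> = min 1 ((p powr p / (2 * B)) powr (1 / (p - 1)))"
  have \<beta>: "0 < \<beta>" "\<beta> \<le> 1"
    using p B by (auto simp: \<beta>_def)
  have small: "B / \<beta> * (\<beta> / p) powr p \<le> 1 / 2"
  proof -
    have "\<beta> powr (p - 1) \<le> ((p powr p / (2 * B)) powr (1 / (p - 1))) powr (p - 1)"
      using \<beta> p by (intro powr_mono2) (auto simp: \<beta>_def)
    also have "\<dots> = p powr p / (2 * B)"
      using p B by (simp add: powr_powr)
    finally have le: "\<beta> powr (p - 1) \<le> p powr p / (2 * B)" .
    have "B / \<beta> * (\<beta> / p) powr p = B / p powr p * \<beta> powr (p - 1)"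
      using \<beta> p by (simp add: powr_divide powr_diff)
    also have "\<dots> \<le> B / p powr p * (p powr p / (2 * B))"
      using B by (intro mult_left_mono le) auto
    also have "\<dots> = 1 / 2"
      using B p by simp
    finally show ?thesis .
  qed
  have "(\<integral>\<^sup>+x\<in>\<Omega>. ennreal (\<bar>u x\<bar> powr p / d x powr p) \<partial>lebesgue)
      \<le> ennreal (2 * B / \<beta>) * (\<integral>\<^sup>+x\<in>\<Omega>. ennreal (norm (grad u x) powr p) \<partial>lebesgue)"
    (is "?I \<le> _ * ?J") if u: "u \<in> Cc_infinity \<Omega>" for u
  proof (cases "?J = \<infinity>")
    case True
    then show ?thesis
      using B \<beta> by (simp add: ennreal_mult_top)
  next
    case False
    then obtain j where j: "0 \<le> j" "?J = ennreal j"
      by (cases ?J) auto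
    \<comment> \<open>Both integrals are now real numbers, so the subtraction can be done in the
      reals.\<close>
    obtain i where i: "0 \<le> i" "?I = ennreal i"
      using hardy_integral_finite[OF u] by (cases ?I) (auto simp: nn_integral_completion)
    have "?I \<le> ennreal (B / \<beta>) * (?J + ennreal ((\<beta> / p) powr p) * ?I)"
      using hardy_with_error_term[OF u \<beta>] by (simp add: nn_integral_completion B_def)
    also have "\<dots> = ennreal (B / \<beta> * (j + (\<beta> / p) powr p * i))"
    proof -
      have "?J + ennreal ((\<beta> / p) powr p) * ?I = ennreal (j + (\<beta> / p) powr p * i)"
        using i j by (simp add: ennreal_mult)
      then show ?thesis
        using B \<beta> i j by (simp only: ennreal_mult divide_nonneg_pos less_imp_le
            add_nonneg_nonneg mult_nonneg_nonneg powr_ge_zero)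
    qed
    finally have "i \<le> B / \<beta> * (j + (\<beta> / p) powr p * i)"
      using B \<beta> i j by (simp add: ennreal_le_iff)
    moreover have "B / \<beta> * (\<beta> / p) powr p * i \<le> 1 / 2 * i"
      by (intro mult_right_mono small i)
    ultimately have "i \<le> B / \<beta> * j + 1 / 2 * i"
      unfolding distrib_left by (simp only: mult.assoc)
    then have "i \<le> 2 * B / \<beta> * j"
      by simp
    then have "ennreal i \<le> ennreal (2 * B / \<beta> * j)"
      by (rule ennreal_leI)
    then show ?thesis
      using B \<beta> i j by (simp only: ennreal_mult divide_nonneg_pos less_imp_le zero_le_numeral
            mult_nonneg_nonneg)
  qed
  moreover have "0 < 2 * B / \<beta>"
    using B \<beta> by simp
  ultimately show ?thesis
    unfolding integral_hardy_def by blast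
qed

end

theorem corollary1p2:
  fixes p :: real and \<Omega> :: "(real ^ 'n) set"
  assumes "1 < p"
    and "is_domain \<Omega>" and "\<Omega> \<noteq> UNIV"
    and "pointwise_hardy p \<Omega>"
  shows "integral_hardy p \<Omega>"
proof -
  obtain C where "0 < C" and C: "\<forall>u\<in>Cc_infinity \<Omega>. \<forall>x\<in>\<Omega>.
        ennreal \<bar>u x\<bar> \<le> ennreal (C * infdist x (frontier \<Omega>)) *
          ennreal_powr
            (restricted_maximal (2 * infdist x (frontier \<Omega>)) (\<lambda>y. norm (grad u y) powr p) x)
            (1 / p)"
    using assms(4) unfolding pointwise_hardy_def by blast
  \<comment> \<open>Only the empty set and the whole space have an empty frontier, and both are
    excluded.\<close>
  have "frontier \<Omega> \<noteq> {}"
    using assms by (simp add: is_domain_def frontier_eq_empty)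
  then interpret pointwise_hardy_domain p C \<Omega>
    using assms \<open>0 < C\<close> C by unfold_locales (auto simp: is_domain_def)
  show ?thesis by (rule integral_hardy)
qed

end
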